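(* Let $r\geq 1$. An element $\mathbf m\in\bigwedge^r M_0$ belongs to the Grassmann cone $\mathcal G_r$ if and only if the equality $$\mathrm{Res}_z\Big[\overline{\sigma}_+(z)\,\overline{\sigma}_{-r+1}\big(\beta_0\lrcorner \sigma_-(z)\mathbf m\big)\otimes \sigma_+(z)\,\overline{\sigma}_-(z)\big(b_0\wedge \overline{\sigma}_r\mathbf m\big)\Big]=0$$ holds in $\bigwedge^{r-1}M_0\otimes_{\mathbb Z}\bigwedge^{r+1}M_0$.
   Context: $M_0$ is a free abelian group with countable basis $(b_0,b_1,b_2,\ldots)$; by convention $b_k=0$ for $k<0$. $(\beta_j)_{j\ge 0}$ is the family of linear forms on $M_0$ with $\beta_j(b_i)=\delta_{ij}$, and $M_0^*=\bigoplus_{j\ge0}\mathbb Z\beta_j$ is the restricted dual. $\bigwedge M_0=\bigoplus_{r\ge 0}\bigwedge^rM_0$ is the exterior algebra over $\mathbb Z$ ($\bigwedge^0M_0=\mathbb Z$). The Grassmann cone $\mathcal G_r\subseteq \bigwedge^rM_0$ is the set of all $m_1\wedge\cdots\wedge m_r$ with $m_1,\ldots,m_r\in M_0$ (the image of $M_0^r\to\bigwedge^rM_0$). Contraction: $\bigwedge^rM_0^*$ is paired with $\bigwedge^rM_0$ by $(\mu_1\wedge\cdots\wedge\mu_r)(m_1\wedge\cdots\wedge m_r)=\det(\mu_i(m_j))$. For $\beta\in M_0^*$ and $\mathbf m\in\bigwedge^rM_0$ ($r\ge1$), $\beta\lrcorner\mathbf m\in\bigwedge^{r-1}M_0$ is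 the unique element with $\gamma(\beta\lrcorner\mathbf m)=(\beta\wedge\gamma)(\mathbf m)$ for all $\gamma\in\bigwedge^{r-1}M_0^*$. Schubert derivations: $\sigma_{\pm}(z)=\sum_{i\ge0}\sigma_{\pm i}z^{\pm i}\in \mathrm{End}_{\mathbb Z}(\bigwedge M_0)[[z^{\pm1}]]$ are the unique formal power series such that $\sigma_\pm(z)(\mathbf m_1\wedge\mathbf m_2)=\sigma_\pm(z)\mathbf m_1\wedge\sigma_\pm(z)\mathbf m_2$ for all $\mathbf m_1,\mathbf m_2\in\bigwedge M_0$ and $\sigma_{\pm i}b_j=b_{j\pm i}$ for all $i,j\geq 0$. $\overline{\sigma}_\pm(z)=\sum_{i\ge0}\overline\sigma_{\pm i}z^{\pm i}$ denotes the inverse of $\sigma_\pm(z)$ in $\mathrm{End}_{\mathbb Z}(\bigwedge M_0)[[z^{\pm1}]]$. All these operators and the contraction are extended linearly to formal Laurent series in $z$ with coefficients in $\bigwedge M_0$. $\mathrm{Res}_z$ denotes the coefficient of $z^{-1}$ of a formal Laurent series; for series $f=\sum f_iz^i$, $g=\sum g_jz^j$ one puts $f\otimes g=\sum (f_i\otimes g_j)z^{i+j}$. *)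

theory Defs
  imports
    "HOL-Library.Poly_Mapping"
    "HOL-Library.Groups_Big_Fun"
    "HOL-Algebra.Free_Abelian_Groups"
    "Jordan_Normal_Form.Determinant"
begin

text \<open>
  Words in the elements of \<open>'m\<close> form the free monoid on \<open>'m\<close>; its monoid ring over the integers
  (finitely supported functions with the convolution product) is the free ring on \<open>'m\<close>.
\<close>

datatype 'm word = Word "'m list"

instantiation word :: (type) monoid_add
begin

definition zero_word :: "'m word" where "zero_word = Word []"

fun plus_word :: "'m word \<Rightarrow> 'm word \<Rightarrow> 'm word" where
  "plus_word (Word u) (Word v) = Word (u @ v)"

instance
proof
  fix a b c :: "'a word"
  show "a + b + c = a + (b + c)" by (cases a; cases b; cases c) simp
  show "0 + a = a" by (cases a) (simp add: zero_word_def)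
  show "a + 0 = a" by (cases a) (simp add: zero_word_def)
qed

end

type_synonym 'm free_ring = "'m word \<Rightarrow>\<^sub>0 int"

definition free_gen :: "'m \<Rightarrow> 'm free_ring" where
  "free_gen m = Poly_Mapping.single (Word [m]) 1"

text \<open>
  The free ring modulo the relations \<open>additive\<close> is the tensor algebra of the abelian group \<open>'m\<close>;
  the relations \<open>alternating\<close> (squares of elements of \<open>'m\<close>) then give the exterior algebra.
\<close>

inductive_set ext_ideal :: "('m::ab_group_add) free_ring set" where
  additive: "free_gen (m + m') - free_gen m - free_gen m' \<in> ext_ideal"
| alternating: "free_gen m * free_gen m \<in> ext_ideal"
| diff: "x \<in> ext_ideal \<Longrightarrow> y \<in> ext_ideal \<Longrightarrow> x - y \<in> ext_ideal"
| left: "x \<in> ext_ideal \<Longrightarrow> a * x \<in> ext_ideal"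
| right: "x \<in> ext_ideal \<Longrightarrow> x * a \<in> ext_ideal"

definition ext_rel :: "('m::ab_group_add) free_ring \<Rightarrow> 'm free_ring \<Rightarrow> bool" where
  "ext_rel x y \<longleftrightarrow> x - y \<in> ext_ideal"

lemma ext_ideal_zero: "0 \<in> ext_ideal"
  using ext_ideal.diff[OF ext_ideal.alternating ext_ideal.alternating, of undefined undefined] by simp

lemma ext_ideal_uminus: "x \<in> ext_ideal \<Longrightarrow> - x \<in> ext_ideal"
  using ext_ideal.diff[OF ext_ideal_zero] by fastforce

lemma ext_ideal_plus: "x \<in> ext_ideal \<Longrightarrow> y \<in> ext_ideal \<Longrightarrow> x + y \<in> ext_ideal"
  using ext_ideal.diff[OF _ ext_ideal_uminus] by fastforce

quotient_type (overloaded) 'm ext = "('m::ab_group_add) free_ring" / ext_rel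
proof (rule equivpI)
  show "reflp ext_rel" by (simp add: reflp_def ext_rel_def ext_ideal_zero)
  show "symp ext_rel"
    unfolding symp_def ext_rel_def by (metis ext_ideal_uminus minus_diff_eq)
  show "transp ext_rel"
    unfolding transp_def ext_rel_def
    by (metis ext_ideal_plus diff_add_cancel add_diff_eq)
qed

lemma word_add_eq_0_iff: "u + v = 0 \<longleftrightarrow> u = 0 \<and> v = (0 :: 'm word)"
  by (cases u; cases v) (simp add: zero_word_def)

lemma lookup_free_mult_0:
  fixes x y :: "'m free_ring"
  shows "Poly_Mapping.lookup (x * y) 0 = Poly_Mapping.lookup x 0 * Poly_Mapping.lookup y 0"
proof -
  have "Poly_Mapping.lookup (x * y) 0 =
    Sum_any (\<lambda>l. Poly_Mapping.lookup x l * Sum_any (\<lambda>q. Poly_Mapping.lookup y q when l = 0 \<and> q = 0))"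
    by (simp add: lookup_mult eq_commute[of 0] word_add_eq_0_iff)
  also have "\<dots> = Sum_any (\<lambda>l. Poly_Mapping.lookup x l * Poly_Mapping.lookup y 0 when l = 0)"
    by (rule Sum_any.cong) (auto simp: when_def)
  finally show ?thesis by simp
qed

lemma ext_ideal_lookup_0: "x \<in> ext_ideal \<Longrightarrow> Poly_Mapping.lookup x 0 = 0"
proof (induction rule: ext_ideal.induct)
  case (additive m m')
  then show ?case by (simp add: lookup_minus free_gen_def lookup_single zero_word_def)
next
  case (alternating m)
  have "Poly_Mapping.lookup (free_gen m) 0 = 0"
    by (simp add: free_gen_def lookup_single zero_word_def)
  then show ?case by (simp add: lookup_free_mult_0)
qed (simp_all add: lookup_free_mult_0 lookup_minus)

instantiation ext :: (ab_group_add) ring_1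
begin

lift_definition zero_ext :: "'a ext" is 0 .
lift_definition one_ext :: "'a ext" is 1 .

lift_definition plus_ext :: "'a ext \<Rightarrow> 'a ext \<Rightarrow> 'a ext" is "(+)"
  unfolding ext_rel_def by (metis ext_ideal_plus add_diff_add)

lift_definition uminus_ext :: "'a ext \<Rightarrow> 'a ext" is uminus
  unfolding ext_rel_def by (metis ext_ideal_uminus minus_diff_minus)

lift_definition minus_ext :: "'a ext \<Rightarrow> 'a ext \<Rightarrow> 'a ext" is "(-)"
proof -
  fix x x' y y' :: "'a free_ring"
  assume "ext_rel x x'" "ext_rel y y'"
  then have "(x - x') - (y - y') \<in> ext_ideal"
    unfolding ext_rel_def by (rule ext_ideal.diff)
  then show "ext_rel (x - y) (x' - y')"
    unfolding ext_rel_def by (simp add: algebra_simps)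
qed

lift_definition times_ext :: "'a ext \<Rightarrow> 'a ext \<Rightarrow> 'a ext" is "(*)"
proof -
  fix x x' y y' :: "'a free_ring"
  assume "ext_rel x x'" "ext_rel y y'"
  then have "(x - x') * y + x' * (y - y') \<in> ext_ideal"
    unfolding ext_rel_def by (intro ext_ideal_plus ext_ideal.left ext_ideal.right)
  then show "ext_rel (x * y) (x' * y')"
    unfolding ext_rel_def by (simp add: algebra_simps)
qed

instance
proof
  show "(0::'a ext) \<noteq> 1"
  proof (transfer, unfold ext_rel_def, rule notI)
    assume "(0::'a free_ring) - 1 \<in> ext_ideal"
    from ext_ideal_lookup_0[OF this] show False by (simp add: lookup_minus lookup_one)
  qed
qed (transfer; simp add: ext_rel_def ext_ideal_zero algebra_simps)+

end

lift_definition ext_gen :: "('m::ab_group_add) \<Rightarrow> 'm ext" is free_gen .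

text \<open>The product of \<open>'m ext\<close> is the exterior product; \<open>wedge [m\<^sub>1, \<dots>, m\<^sub>r]\<close> is
  \<open>m\<^sub>1 \<and> \<dots> \<and> m\<^sub>r\<close>.\<close>

definition wedge :: "('m::ab_group_add) list \<Rightarrow> 'm ext" where
  "wedge ms = prod_list (map ext_gen ms)"

text \<open>The \<open>r\<close>-th exterior power, as an additive subgroup of the exterior algebra.\<close>

inductive_set ext_power :: "nat \<Rightarrow> ('m::ab_group_add) ext set" for r where
  wedge: "length ms = r \<Longrightarrow> wedge ms \<in> ext_power r"
| diff: "x \<in> ext_power r \<Longrightarrow> y \<in> ext_power r \<Longrightarrow> x - y \<in> ext_power r"

definition tensor_relations ::
  "('a::ab_group_add) set \<Rightarrow> ('b::ab_group_add) set \<Rightarrow> ('a \<times> 'b \<Rightarrow>\<^sub>0 int) set" where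
  "tensor_relations A B =
     {frag_of (a + a', b) - frag_of (a, b) - frag_of (a', b) | a a' b. a \<in> A \<and> a' \<in> A \<and> b \<in> B} \<union>
     {frag_of (a, b + b') - frag_of (a, b) - frag_of (a, b') | a b b'. a \<in> A \<and> b \<in> B \<and> b' \<in> B}"

definition tensor_null ::
  "('a::ab_group_add) set \<Rightarrow> ('b::ab_group_add) set \<Rightarrow> ('a \<times> 'b \<Rightarrow>\<^sub>0 int) set" where
  "tensor_null A B = generate (free_Abelian_group (A \<times> B)) (tensor_relations A B)"

definition tensor_product ::
  "('a::ab_group_add) set \<Rightarrow> ('b::ab_group_add) set \<Rightarrow> ('a \<times> 'b \<Rightarrow>\<^sub>0 int) set monoid" where
  "tensor_product A B = free_Abelian_group (A \<times> B) Mod tensor_null A B"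

lemma comm_group_tensor_product:
  assumes "\<And>x y. x \<in> A \<Longrightarrow> y \<in> A \<Longrightarrow> x + y \<in> A" "\<And>x y. x \<in> B \<Longrightarrow> y \<in> B \<Longrightarrow> x + y \<in> B"
  shows "comm_group (tensor_product A B)"
proof -
  interpret F: comm_group "free_Abelian_group (A \<times> B)"
    by (rule abelian_free_Abelian_group)
  have frag: "frag_of (x, y) \<in> {c. Poly_Mapping.keys c \<subseteq> A \<times> B}" if "x \<in> A" "y \<in> B" for x y
    using that by simp
  have diff: "c - d \<in> {c. Poly_Mapping.keys c \<subseteq> A \<times> B}"
    if "c \<in> {c. Poly_Mapping.keys c \<subseteq> A \<times> B}" "d \<in> {c. Poly_Mapping.keys c \<subseteq> A \<times> B}" for c d
    using that keys_diff[of c d] by blast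
  have "tensor_relations A B \<subseteq> carrier (free_Abelian_group (A \<times> B))"
    unfolding free_Abelian_group_def partial_object.simps tensor_relations_def
    by (intro Un_least subsetI; elim CollectE exE conjE; simp only:; intro diff frag assms)
  then have "subgroup (tensor_null A B) (free_Abelian_group (A \<times> B))"
    unfolding tensor_null_def by (rule F.generate_is_subgroup)
  then show ?thesis
    unfolding tensor_product_def by (rule F.abelian_FactGroup)
qed

definition pure_tensor ::
  "('a::ab_group_add) set \<Rightarrow> ('b::ab_group_add) set \<Rightarrow> 'a \<Rightarrow> 'b \<Rightarrow> ('a \<times> 'b \<Rightarrow>\<^sub>0 int) set" where
  "pure_tensor A B a b = tensor_null A B #>\<^bsub>free_Abelian_group (A \<times> B)\<^esub> frag_of (a, b)"

type_synonym M0 = "nat \<Rightarrow>\<^sub>0 int"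

definition bvec :: "int \<Rightarrow> M0" where
  "bvec k = (if k < 0 then 0 else Poly_Mapping.single (nat k) 1)"

text \<open>An element \<open>\<mu>\<close> of the restricted dual is given by its coordinates in the family
  \<open>\<beta>\<^sub>0, \<beta>\<^sub>1, \<dots>\<close>; the linear form itself is \<open>eval_form \<mu>\<close>.\<close>

type_synonym M0_dual = "nat \<Rightarrow>\<^sub>0 int"

definition bform :: "nat \<Rightarrow> M0_dual" where
  "bform j = Poly_Mapping.single j 1"

definition eval_form :: "M0_dual \<Rightarrow> M0 \<Rightarrow> int" where
  "eval_form \<mu> m = (\<Sum>j\<in>Poly_Mapping.keys \<mu>. Poly_Mapping.lookup \<mu> j * Poly_Mapping.lookup m j)"

lemma eval_form_bform_bvec: "eval_form (bform j) (bvec (int i)) = (if i = j then 1 else 0)"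
  by (simp add: eval_form_def bform_def bvec_def lookup_single when_def)

definition grassmann_cone :: "nat \<Rightarrow> M0 ext set" where
  "grassmann_cone r = {wedge ms | ms. length ms = r}"

text \<open>The pairings of the exterior powers of equal degree, combined into one biadditive map by
  letting different degrees be orthogonal.\<close>

definition is_ext_pairing :: "(M0_dual ext \<Rightarrow> M0 ext \<Rightarrow> int) \<Rightarrow> bool" where
  "is_ext_pairing P \<longleftrightarrow>
     (\<forall>\<gamma> \<gamma>' x. P (\<gamma> + \<gamma>') x = P \<gamma> x + P \<gamma>' x) \<and>
     (\<forall>\<gamma> x x'. P \<gamma> (x + x') = P \<gamma> x + P \<gamma> x') \<and>
     (\<forall>\<mu>s ms. P (wedge \<mu>s) (wedge ms) =
        (if length \<mu>s = length ms
         then det (mat (length ms) (length ms) (\<lambda>(i, j). eval_form (\<mu>s ! i) (ms ! j)))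
         else 0))"

definition ext_pairing :: "M0_dual ext \<Rightarrow> M0 ext \<Rightarrow> int" where
  "ext_pairing = (THE P. is_ext_pairing P)"

text \<open>Contraction of an element of the \<open>r\<close>-th exterior power, for \<open>r \<ge> 1\<close>.\<close>

definition contract :: "nat \<Rightarrow> M0_dual \<Rightarrow> M0 ext \<Rightarrow> M0 ext" where
  "contract r \<mu> m = (THE x. x \<in> ext_power (r - 1) \<and>
     (\<forall>\<gamma> \<in> ext_power (r - 1). ext_pairing \<gamma> x = ext_pairing (ext_gen \<mu> * \<gamma>) m))"

text \<open>
  A series \<open>\<Sum>i\<ge>0. s\<^sub>i z\<^sup>\<epsilon>\<^sup>i\<close>, \<open>\<epsilon> \<in> {1, -1}\<close>, of endomorphisms is represented by the sequence
  \<open>s\<close>, so that \<open>schubert (-1) i\<close> is the coefficient of \<open>z\<^sup>-\<^sup>i\<close>.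
\<close>

definition is_schubert :: "int \<Rightarrow> (nat \<Rightarrow> M0 ext \<Rightarrow> M0 ext) \<Rightarrow> bool" where
  "is_schubert \<epsilon> s \<longleftrightarrow>
     (\<forall>n x y. s n (x + y) = s n x + s n y) \<and>
     (\<forall>n x y. s n (x * y) = (\<Sum>i\<le>n. s i x * s (n - i) y)) \<and>
     (\<forall>i j. s i (ext_gen (bvec (int j))) = ext_gen (bvec (int j + \<epsilon> * int i)))"

definition schubert :: "int \<Rightarrow> nat \<Rightarrow> M0 ext \<Rightarrow> M0 ext" where
  "schubert \<epsilon> = (THE s. is_schubert \<epsilon> s)"

definition is_series_inverse ::
  "(nat \<Rightarrow> M0 ext \<Rightarrow> M0 ext) \<Rightarrow> (nat \<Rightarrow> M0 ext \<Rightarrow> M0 ext) \<Rightarrow> bool" where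
  "is_series_inverse s t \<longleftrightarrow>
     (\<forall>n x y. t n (x + y) = t n x + t n y) \<and>
     (\<forall>n x. (\<Sum>i\<le>n. s i (t (n - i) x)) = (if n = 0 then x else 0)) \<and>
     (\<forall>n x. (\<Sum>i\<le>n. t i (s (n - i) x)) = (if n = 0 then x else 0))"

definition schubert_inv :: "int \<Rightarrow> nat \<Rightarrow> M0 ext \<Rightarrow> M0 ext" where
  "schubert_inv \<epsilon> = (THE t. is_series_inverse (schubert \<epsilon>) t)"

abbreviation sigma_plus where "sigma_plus \<equiv> schubert 1"
abbreviation sigma_minus where "sigma_minus \<equiv> schubert (-1)"
abbreviation sigma_bar_plus where "sigma_bar_plus \<equiv> schubert_inv 1"
abbreviation sigma_bar_minus where "sigma_bar_minus \<equiv> schubert_inv (-1)"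

text \<open>
  A Laurent series in \<open>z\<close> is represented by its coefficient function \<open>int \<Rightarrow> M0 ext\<close>, so a single
  operator is extended linearly to series by composition. The sums below have only finitely many
  nonzero terms when a series in \<open>z\<close> acts on a series bounded below, when a series in
  \<open>z\<^sup>-\<^sup>1\<close> acts on a series bounded above, and when at least one of the factors of a residue is a
  Laurent polynomial and the other one is bounded below.
\<close>

type_synonym laurent = "int \<Rightarrow> M0 ext"

definition laurent_const :: "M0 ext \<Rightarrow> laurent" where
  "laurent_const m n = (if n = 0 then m else 0)"

text \<open>The action of \<open>\<Sum>i\<ge>0. s\<^sub>i z\<^sup>\<epsilon>\<^sup>i\<close> on a Laurent series.\<close>

definition series_apply :: "int \<Rightarrow> (nat \<Rightarrow> M0 ext \<Rightarrow> M0 ext) \<Rightarrow> laurent \<Rightarrow> laurent" where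
  "series_apply \<epsilon> s f n = Sum_any (\<lambda>i. s i (f (n - \<epsilon> * int i)))"

text \<open>The coefficient of \<open>z\<^sup>-\<^sup>1\<close> of \<open>f \<otimes> g\<close>, in the tensor product of \<open>A\<close> and \<open>B\<close>.\<close>

definition residue_tensor ::
  "M0 ext set \<Rightarrow> M0 ext set \<Rightarrow> laurent \<Rightarrow> laurent \<Rightarrow> (M0 ext \<times> M0 ext \<Rightarrow>\<^sub>0 int) set" where
  "residue_tensor A B f g =
     finprod (tensor_product A B) (\<lambda>i. pure_tensor A B (f i) (g (- 1 - i)))
       {i. f i \<noteq> 0 \<and> g (- 1 - i) \<noteq> 0}"

end

(* On the r-th exterior power sbar_+(z) has degree r in z and sbar_-(z) sbar_r = z^(-r) sbar_+(z), so
   the second factor is z^(-r) b(z) wedge m with b(z) = sum_i b_i z^i. Contraction with beta_0 composed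
   with sigma_-(z) equals sigma_-(z) composed with contraction with beta(z) = sum_i beta_i z^(-i). The
   result is killed by beta_0, hence a combination of products of vectors b_(i+1), on which
   sbar_+(z) sbar_(-r+1) = z^(r-1) sbar_-(z); so the first factor is z^(r-1) times the contraction of
   m with beta(z). The residue is therefore the Pluecker tensor
   sum_i (beta_i contracted with m) (x) (b_i wedge m).
   It vanishes on decomposable m by bilinearity. Conversely, if it vanishes, one splits off from m a
   primitive integral vector at a time, which keeps all coefficients integral. *)

theory Submission
  imports Defs "HOL-Computational_Algebra.Formal_Power_Series"
begin

text \<open>Let S be the index shift by one. On vectors a Schubert series is the geometric series of
  z S, so its inverse is v - z S v and takes a product of r vectors to a polynomial of degree at
  most r in z. The top coefficient of that polynomial is the product of the vectors -S v, and v - z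
  S v = -z (S v - z^(-1) v); the two exchange rules between opposite series come from this identity.
  They require the opposite shift to undo S. Up and then down is the identity, while down and then
  up loses the coordinate at b_0; this asymmetry is why the first factor must be shown to lie in the
  kernel of beta_0. Pairing, contraction, Schubert series and their inverses are given by definite
  descriptions, so existence and uniqueness come before any computation. Bases of exterior powers
  and of tensor products are avoided: elements are written recursively as a + b_n c, with c
  recovered by contraction with beta_n, and tensors are tested by biadditive maps (a, b) -> gamma(a)
  b.\<close>

lemma additive_diff:
  fixes f :: "'a::ab_group_add \<Rightarrow> 'b::ab_group_add"
  assumes "\<And>x y. f (x + y) = f x + f y"
  shows "f (x - y) = f x - f y"
  by (metis assms add_diff_cancel diff_add_cancel)

lemma additive_zero:
  fixes f :: "'a::ab_group_add \<Rightarrow> 'b::ab_group_add"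
  assumes "\<And>x y. f (x + y) = f x + f y"
  shows "f 0 = 0"
  using additive_diff[of f 0 0] assms by simp

lemma additive_uminus:
  fixes f :: "'a::ab_group_add \<Rightarrow> 'b::ab_group_add"
  assumes "\<And>x y. f (x + y) = f x + f y"
  shows "f (- x) = - f x"
  using additive_diff[of f 0 x] additive_zero[of f] assms by simp

lemma additive_sum:
  fixes f :: "'a::ab_group_add \<Rightarrow> 'b::ab_group_add"
  assumes "\<And>x y. f (x + y) = f x + f y"
  shows "f (\<Sum>i\<in>I. g i) = (\<Sum>i\<in>I. f (g i))"
  by (induction I rule: infinite_finite_induct) (simp_all add: assms additive_zero)

lemma additive_of_int_mult:
  fixes f :: "'a::ring_1 \<Rightarrow> 'b::ring_1"
  assumes add: "\<And>x y. f (x + y) = f x + f y"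
  shows "f (of_int c * x) = of_int c * f x"
proof (induction c rule: int_induct[of _ 0])
  case base
  then show ?case by (simp add: additive_zero[of f, OF add])
next
  case (step1 i)
  then show ?case by (simp add: distrib_right add)
next
  case (step2 i)
  then show ?case by (simp add: left_diff_distrib additive_diff[of f, OF add])
qed

section \<open>The universal property of the exterior algebra\<close>

text \<open>The conditions mirror the two kinds of generators of \<open>ext_ideal\<close>, placed
  between arbitrary words; hence only adjacent equal entries matter. Lists of all lengths are
  treated at once, so no degree has to be fixed.\<close>

definition alternating_multilinear :: "('m::ab_group_add list \<Rightarrow> 'a::ring_1) \<Rightarrow> bool" where
  "alternating_multilinear F \<longleftrightarrow>
     (\<forall>u v m m'. F (u @ (m + m') # v) = F (u @ m # v) + F (u @ m' # v)) \<and>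
     (\<forall>u v m. F (u @ m # m # v) = 0)"

definition free_extend :: "('k \<Rightarrow> 'a::ring_1) \<Rightarrow> ('k \<Rightarrow>\<^sub>0 int) \<Rightarrow> 'a" where
  "free_extend F x = (\<Sum>w\<in>Poly_Mapping.keys x. of_int (Poly_Mapping.lookup x w) * F w)"

lemma free_extend_superset:
  assumes "finite K" "Poly_Mapping.keys x \<subseteq> K"
  shows "free_extend F x = (\<Sum>w\<in>K. of_int (Poly_Mapping.lookup x w) * F w)"
  unfolding free_extend_def
  by (rule sum.mono_neutral_left) (use assms in \<open>auto simp: in_keys_iff\<close>)

lemma free_extend_add: "free_extend F (x + y) = free_extend F x + free_extend F y"
proof -
  let ?K = "Poly_Mapping.keys x \<union> Poly_Mapping.keys y"
  have "free_extend F (x + y) = (\<Sum>w\<in>?K. of_int (Poly_Mapping.lookup (x + y) w) * F w)"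
    by (rule free_extend_superset) (simp_all add: Poly_Mapping.keys_add)
  also have "\<dots> = free_extend F x + free_extend F y"
    by (simp add: lookup_add distrib_right sum.distrib free_extend_superset[of ?K])
  finally show ?thesis .
qed

lemmas free_extend_diff = additive_diff[of "free_extend F" for F, OF free_extend_add]
lemmas free_extend_zero = additive_zero[of "free_extend F" for F, OF free_extend_add]

lemma free_extend_frag_of [simp]: "free_extend F (frag_of w) = F w"
  by (simp add: free_extend_def)

lemma frag_induct [case_names zero one diff]:
  assumes "P 0" "\<And>w. P (frag_of w)" "\<And>x y. P x \<Longrightarrow> P y \<Longrightarrow> P (x - y)"
  shows "P (x :: 'k \<Rightarrow>\<^sub>0 int)"
  by (rule frag_induction[of x UNIV]) (use assms in auto)

lemma frag_of_word_mult: "frag_of (Word u) * frag_of (Word v) = frag_of (Word (u @ v))"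
  by (simp add: mult_single)

fun letters :: "'m word \<Rightarrow> 'm list" where "letters (Word u) = u"

lemma free_extend_two_sided_zero:
  assumes "\<And>u v. free_extend F (frag_of (Word u) * x * frag_of (Word v)) = 0"
  shows "free_extend F (a * x * b) = 0"
proof -
  have "free_extend F (frag_of (Word u) * x * b) = 0" for u
  proof (induction b rule: frag_induct)
    case (one w)
    then show ?case by (cases w) (simp add: assms)
  qed (simp_all add: free_extend_zero free_extend_diff right_diff_distrib)
  then show ?thesis
  proof (induction a rule: frag_induct)
    case (one w)
    then show ?case by (cases w) simp
  qed (simp_all add: free_extend_zero free_extend_diff left_diff_distrib)
qed

text \<open>The free multipliers \<open>a\<close> and \<open>b\<close> make the induction work: the
  closure rules \<open>left\<close> and \<open>right\<close> of the ideal are absorbed into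
  them.\<close>

lemma free_extend_ideal:
  assumes F: "alternating_multilinear F" and "x \<in> ext_ideal"
  shows "free_extend (F \<circ> letters) (a * x * b) = 0"
  using assms(2)
proof (induction arbitrary: a b rule: ext_ideal.induct)
  case (additive m m')
  show ?case
    by (rule free_extend_two_sided_zero)
      (use F in \<open>simp add: free_gen_def algebra_simps frag_of_word_mult free_extend_diff
          free_extend_add alternating_multilinear_def mult_single\<close>)
next
  case (alternating m)
  show ?case
    by (rule free_extend_two_sided_zero)
      (use F in \<open>simp add: free_gen_def mult_single alternating_multilinear_def\<close>)
next
  case (diff x y)
  then show ?case by (simp add: algebra_simps free_extend_diff)
next
  case (left x c)
  from left.IH[of "a * c" b] show ?case by (simp add: mult.assoc)
next
  case (right x c)
  from right.IH[of a "c * b"] show ?case by (simp add: mult.assoc)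
qed

text \<open>The value does not depend on the representative when \<open>F\<close> is alternating
  multilinear. \<open>F\<close> need not be multiplicative, so the same lift serves for interior
  products, pairings and ring homomorphisms.\<close>

definition ext_lift :: "('m::ab_group_add list \<Rightarrow> 'a::ring_1) \<Rightarrow> 'm ext \<Rightarrow> 'a" where
  "ext_lift F x = free_extend (F \<circ> letters) (rep_ext x)"

lemma ext_lift_abs:
  assumes "alternating_multilinear F"
  shows "ext_lift F (abs_ext y) = free_extend (F \<circ> letters) y"
proof -
  have "ext_rel (rep_ext (abs_ext y)) y"
    by (rule Quotient3_rep_abs[OF Quotient3_ext]) (simp add: ext_rel_def ext_ideal_zero)
  then have "rep_ext (abs_ext y) - y \<in> ext_ideal" by (simp add: ext_rel_def)
  from free_extend_ideal[OF assms this, of 1 1] show ?thesis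
    by (simp add: ext_lift_def free_extend_diff)
qed

lemma wedge_Nil [simp]: "wedge [] = 1"
  and wedge_Cons [simp]: "wedge (m # ms) = ext_gen m * wedge ms"
  and wedge_append: "wedge (us @ vs) = wedge us * wedge vs"
  by (simp_all add: wedge_def)

lemma abs_ext_word: "abs_ext (frag_of (Word u)) = wedge u"
proof (induction u)
  case Nil
  then show ?case by (simp add: one_ext_def single_one[symmetric] zero_word_def[symmetric] del: single_one)
next
  case (Cons m u)
  have "frag_of (Word (m # u)) = free_gen m * frag_of (Word u)"
    by (simp add: free_gen_def mult_single)
  then show ?case by (simp add: times_ext.abs_eq[symmetric] Cons ext_gen.abs_eq)
qed

lemma ext_induct [case_names wedge diff]:
  assumes "\<And>ms. P (wedge ms)" "\<And>x y. P x \<Longrightarrow> P y \<Longrightarrow> P (x - y)"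
  shows "P x"
proof -
  have "P (abs_ext y)" for y
  proof (induction y rule: frag_induct)
    case zero
    show ?case
      using assms(2)[OF assms(1) assms(1), of "[]" "[]"] by (simp add: zero_ext_def)
  next
    case (one w)
    then show ?case by (cases w) (simp add: abs_ext_word assms(1))
  next
    case (diff x y)
    then show ?case by (simp add: assms(2) minus_ext.abs_eq[symmetric])
  qed
  then show ?thesis by (metis Quotient3_abs_rep[OF Quotient3_ext])
qed

lemma ext_lift_wedge [simp]:
  assumes "alternating_multilinear F"
  shows "ext_lift F (wedge ms) = F ms"
  using ext_lift_abs[OF assms, of "frag_of (Word ms)"] by (simp add: abs_ext_word)

lemma ext_lift_add:
  assumes "alternating_multilinear F"
  shows "ext_lift F (x + y) = ext_lift F x + ext_lift F y"
proof -
  obtain x' y' where "x = abs_ext x'" "y = abs_ext y'"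
    by (metis Quotient3_abs_rep[OF Quotient3_ext])
  then show ?thesis
    by (simp add: plus_ext.abs_eq ext_lift_abs[OF assms] free_extend_add)
qed

lemma ext_gen_add: "ext_gen (m + m') = ext_gen m + ext_gen m'"
  using ext_ideal.additive[of m m']
  by (transfer) (simp add: ext_rel_def algebra_simps)

lemma ext_gen_sq [simp]: "ext_gen m * ext_gen m = 0"
  using ext_ideal.alternating[of m]
  by (transfer) (simp add: ext_rel_def)

lemma ext_gen_sq_left [simp]: "ext_gen m * (ext_gen m * x) = 0"
  by (simp add: mult.assoc[symmetric])

lemmas ext_gen_zero [simp] = additive_zero[of ext_gen, OF ext_gen_add]
lemmas ext_gen_diff = additive_diff[of ext_gen, OF ext_gen_add]
lemmas ext_gen_uminus = additive_uminus[of ext_gen, OF ext_gen_add]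
lemmas ext_gen_sum = additive_sum[of ext_gen, OF ext_gen_add]

lemma ext_gen_anticommute: "ext_gen m * ext_gen m' = - (ext_gen m' * ext_gen m)"
  using ext_gen_sq[of "m + m'"] by (simp add: ext_gen_add algebra_simps eq_neg_iff_add_eq_0)

lemma ext_gen_anticommute_left: "ext_gen m * (ext_gen m' * x) = - (ext_gen m' * (ext_gen m * x))"
  by (simp only: mult.assoc[symmetric] ext_gen_anticommute[of m m'] mult_minus_left)

lemma ext_additive_eqI:
  fixes f g :: "'m::ab_group_add ext \<Rightarrow> 'b::ab_group_add"
  assumes "\<And>x y. f (x + y) = f x + f y" "\<And>x y. g (x + y) = g x + g y"
    and "\<And>ms. f (wedge ms) = g (wedge ms)"
  shows "f x = g x"
  by (induction x rule: ext_induct) (simp_all add: assms additive_diff[of f] additive_diff[of g])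

section \<open>Exterior powers\<close>

lemma ext_power_zero [simp]: "0 \<in> ext_power r"
  using ext_power.diff[OF ext_power.wedge ext_power.wedge, of "replicate r 0" r "replicate r 0"]
  by simp

lemma ext_power_uminus: "x \<in> ext_power r \<Longrightarrow> - x \<in> ext_power r"
  using ext_power.diff[OF ext_power_zero, of x r] by simp

lemma ext_power_add: "x \<in> ext_power r \<Longrightarrow> y \<in> ext_power r \<Longrightarrow> x + y \<in> ext_power r"
  using ext_power.diff[OF _ ext_power_uminus, of x r y] by simp

lemma ext_power_sum: "(\<And>i. i \<in> I \<Longrightarrow> f i \<in> ext_power r) \<Longrightarrow> (\<Sum>i\<in>I. f i) \<in> ext_power r"
  by (induction I rule: infinite_finite_induct) (simp_all add: ext_power_add)

lemma ext_power_Suc: "x \<in> ext_power r \<Longrightarrow> ext_gen m * x \<in> ext_power (Suc r)"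
proof (induction rule: ext_power.induct)
  case (wedge ms)
  then show ?case using ext_power.wedge[of "m # ms" "Suc r"] by simp
qed (simp add: right_diff_distrib ext_power.diff)

lemma ext_power_1:
  assumes "x \<in> ext_power (Suc 0)"
  obtains m where "x = ext_gen m"
proof -
  from assms have "\<exists>m. x = ext_gen m"
  proof (induction rule: ext_power.induct)
    case (wedge ms)
    then show ?case by (cases ms) auto
  qed (metis ext_gen_diff)
  then show thesis using that by blast
qed

lemma ext_power_of_int: "x \<in> ext_power 0 \<Longrightarrow> \<exists>c. x = of_int c"
proof (induction rule: ext_power.induct)
  case (wedge ms)
  then show ?case by (metis length_0_conv of_int_1 wedge_Nil)
qed (metis of_int_diff)

text \<open>Projection to degree zero. It shows that the integers embed in the exterior algebra, and
  it ends the chain of contractions that defines the pairing.\<close>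

definition augmentation :: "'m::ab_group_add ext \<Rightarrow> int" where
  "augmentation = ext_lift (\<lambda>ms. if ms = [] then 1 else 0)"

lemma augmentation_alternating:
  "alternating_multilinear (\<lambda>ms::'m::ab_group_add list. if ms = [] then 1::int else 0)"
  by (simp add: alternating_multilinear_def)

lemma augmentation_wedge: "augmentation (wedge ms) = (if ms = [] then 1 else 0)"
  unfolding augmentation_def by (simp add: augmentation_alternating)

lemma augmentation_1 [simp]: "augmentation 1 = 1"
  using augmentation_wedge[of "[]"] by simp

lemma augmentation_add: "augmentation (x + y) = augmentation x + augmentation y"
  unfolding augmentation_def by (rule ext_lift_add[OF augmentation_alternating])

lemmas augmentation_diff = additive_diff[of augmentation, OF augmentation_add]

lemma augmentation_of_int [simp]: "augmentation (of_int c) = c"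
  using additive_of_int_mult[of augmentation c 1, OF augmentation_add] by simp

lemma augmentation_ext_power: "x \<in> ext_power r \<Longrightarrow> r > 0 \<Longrightarrow> augmentation x = 0"
  by (induction rule: ext_power.induct)
    (auto simp: augmentation_wedge augmentation_diff)

section \<open>Interior multiplication and the pairing\<close>

text \<open>The antiderivation of degree -1 that extends \<open>\<phi>\<close>; the recursion is its
  signed Leibniz rule with the head of the list as first factor.\<close>

fun interior_wedge :: "('m::ab_group_add \<Rightarrow> int) \<Rightarrow> 'm list \<Rightarrow> 'm ext" where
  "interior_wedge \<phi> [] = 0"
| "interior_wedge \<phi> (m # ms) = of_int (\<phi> m) * wedge ms - ext_gen m * interior_wedge \<phi> ms"

definition interior :: "('m::ab_group_add \<Rightarrow> int) \<Rightarrow> 'm ext \<Rightarrow> 'm ext" where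
  "interior \<phi> = ext_lift (interior_wedge \<phi>)"

lemma of_int_gen_mult: "ext_gen m * (of_int c * x) = of_int c * (ext_gen m * x)"
  by (simp only: mult.assoc[symmetric] mult_of_int_commute[of c "ext_gen m"])

locale linear_form =
  fixes \<phi> :: "'m::ab_group_add \<Rightarrow> int"
  assumes add: "\<phi> (m + m') = \<phi> m + \<phi> m'"
begin

lemma interior_wedge_alternating: "alternating_multilinear (interior_wedge \<phi>)"
  unfolding alternating_multilinear_def
proof (intro conjI allI)
  fix u v m m'
  show "interior_wedge \<phi> (u @ (m + m') # v) =
      interior_wedge \<phi> (u @ m # v) + interior_wedge \<phi> (u @ m' # v)"
    by (induction u) (simp_all add: add ext_gen_add wedge_append algebra_simps)
  show "interior_wedge \<phi> (u @ m # m # v) = 0"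
    by (induction u) (simp_all add: wedge_append right_diff_distrib of_int_gen_mult)
qed

lemma interior_add: "interior \<phi> (x + y) = interior \<phi> x + interior \<phi> y"
  unfolding interior_def by (rule ext_lift_add[OF interior_wedge_alternating])

lemmas interior_diff = additive_diff[of "interior \<phi>", OF interior_add]
lemmas interior_zero [simp] = additive_zero[of "interior \<phi>", OF interior_add]
lemmas interior_sum = additive_sum[of "interior \<phi>", OF interior_add]
lemmas interior_of_int_mult = additive_of_int_mult[of "interior \<phi>", OF interior_add]

lemma interior_eq_wedge: "interior \<phi> (wedge ms) = interior_wedge \<phi> ms"
  unfolding interior_def by (simp add: interior_wedge_alternating)

lemma interior_1 [simp]: "interior \<phi> 1 = 0"
  using interior_eq_wedge[of "[]"] by simp

lemma interior_of_int [simp]: "interior \<phi> (of_int c) = 0"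
  using interior_of_int_mult[of c 1] by simp

lemma interior_gen_mult: "interior \<phi> (ext_gen m * x) = of_int (\<phi> m) * x - ext_gen m * interior \<phi> x"
proof (induction x rule: ext_induct)
  case (wedge ms)
  then show ?case using interior_eq_wedge[of "m # ms"] interior_eq_wedge[of ms] by simp
qed (simp add: right_diff_distrib interior_diff)

lemma interior_gen [simp]: "interior \<phi> (ext_gen m) = of_int (\<phi> m)"
  using interior_gen_mult[of m 1] by simp

lemma interior_sq [simp]: "interior \<phi> (interior \<phi> x) = 0"
proof (induction x rule: ext_induct)
  case (wedge ms)
  then show ?case
    by (induction ms)
      (simp_all add: interior_gen_mult interior_diff interior_of_int_mult)
qed (simp add: interior_diff)

lemma interior_ext_power: "x \<in> ext_power (Suc r) \<Longrightarrow> interior \<phi> x \<in> ext_power r"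
proof (induction rule: ext_power.induct)
  case (wedge ms)
  have "of_int c * x \<in> ext_power s" if "x \<in> ext_power s" for c s and x :: "'m ext"
  proof (induction c rule: int_induct[of _ 0])
    case base
    show ?case by simp
  next
    case (step1 i)
    then show ?case by (simp add: distrib_right ext_power_add that)
  next
    case (step2 i)
    then show ?case by (simp add: left_diff_distrib ext_power.diff that)
  qed
  then show ?case using wedge
  proof (induction ms arbitrary: r)
    case (Cons m ms)
    show ?case
    proof (cases ms)
      case Nil
      have "(1 :: 'm ext) \<in> ext_power 0" using ext_power.wedge[of "[]"] by simp
      from Cons.prems(1)[OF this, of "\<phi> m"] show ?thesis using Nil Cons.prems(2) by simp
    next
      case (Cons m' ms')
      then obtain r' where r: "r = Suc r'" using \<open>length (m # ms) = Suc r\<close> by auto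
      then have "interior \<phi> (wedge ms) \<in> ext_power r'" using Cons.IH Cons.prems by simp
      moreover have "wedge ms \<in> ext_power r" by (rule ext_power.wedge) (use Cons.prems(2) in simp)
      ultimately show ?thesis
        unfolding wedge_Cons interior_gen_mult r
        by (intro ext_power.diff ext_power_Suc Cons.prems(1))
    qed
  qed simp
qed (simp add: interior_diff ext_power.diff)

text \<open>Unrolled Leibniz rule. This is the shape of a Laplace expansion along a row, and it
  exposes the coordinates needed for the Pluecker tensor.\<close>

lemma interior_wedge_expansion:
  "interior \<phi> (wedge ms) =
    (\<Sum>j<length ms. of_int ((-1) ^ j * \<phi> (ms ! j)) * wedge (take j ms @ drop (Suc j) ms))"
proof (induction ms)
  case (Cons m ms)
  have "interior \<phi> (wedge (m # ms)) = of_int (\<phi> m) * wedge ms -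
      (\<Sum>j<length ms. ext_gen m * (of_int ((-1) ^ j * \<phi> (ms ! j)) * wedge (take j ms @ drop (Suc j) ms)))"
    by (simp add: interior_gen_mult Cons sum_distrib_left)
  also have "\<dots> = of_int (\<phi> m) * wedge ms +
      (\<Sum>j<length ms. of_int ((-1) ^ Suc j * \<phi> (ms ! j)) * wedge (m # (take j ms @ drop (Suc j) ms)))"
    by (simp add: of_int_gen_mult sum_negf del: of_int_mult of_int_power)
  also have "\<dots> = (\<Sum>j<Suc (length ms). of_int ((-1) ^ j * \<phi> ((m # ms) ! j)) *
      wedge (take j (m # ms) @ drop (Suc j) (m # ms)))"
    by (subst sum.lessThan_Suc_shift) simp
  finally show ?case by simp
qed simp

end

text \<open>After two Leibniz steps on a product m * x, the scalar terms are antisymmetric in the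
  two forms, and what remains is m times the double contraction of x.\<close>

lemma interior_anticommute:
  assumes "linear_form \<phi>" "linear_form \<psi>"
  shows "interior \<phi> (interior \<psi> x) = - interior \<psi> (interior \<phi> x)"
proof -
  interpret f: linear_form \<phi> by fact
  interpret g: linear_form \<psi> by fact
  show ?thesis
  proof (induction x rule: ext_induct)
    case (wedge ms)
    then show ?case
      by (induction ms)
        (simp_all add: f.interior_gen_mult g.interior_gen_mult f.interior_diff g.interior_diff
          f.interior_of_int_mult g.interior_of_int_mult)
  qed (simp add: f.interior_diff g.interior_diff)
qed

lemma interior_form_add:
  assumes "linear_form \<phi>" "linear_form \<psi>"
  shows "interior (\<lambda>m. \<phi> m + \<psi> m) x = interior \<phi> x + interior \<psi> x"
proof -
  interpret f: linear_form \<phi> by fact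
  interpret g: linear_form \<psi> by fact
  interpret h: linear_form "\<lambda>m. \<phi> m + \<psi> m" by unfold_locales (simp add: f.add g.add)
  show ?thesis
  proof (induction x rule: ext_induct)
    case (wedge ms)
    then show ?case
      by (induction ms)
        (simp_all add: f.interior_gen_mult g.interior_gen_mult h.interior_gen_mult algebra_simps)
  qed (simp add: f.interior_diff g.interior_diff h.interior_diff)
qed

section \<open>The restricted dual, contraction and the determinant pairing\<close>

lemma eval_form_superset:
  assumes "finite K" "Poly_Mapping.keys \<mu> \<subseteq> K"
  shows "eval_form \<mu> m = (\<Sum>j\<in>K. Poly_Mapping.lookup \<mu> j * Poly_Mapping.lookup m j)"
  unfolding eval_form_def
  by (rule sum.mono_neutral_left) (use assms in \<open>auto simp: in_keys_iff\<close>)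

lemma eval_form_add_right: "eval_form \<mu> (m + m') = eval_form \<mu> m + eval_form \<mu> m'"
  by (simp add: eval_form_def lookup_add distrib_left sum.distrib)

lemma eval_form_add_left: "eval_form (\<mu> + \<mu>') m = eval_form \<mu> m + eval_form \<mu>' m"
proof -
  let ?K = "Poly_Mapping.keys \<mu> \<union> Poly_Mapping.keys \<mu>'"
  have "eval_form (\<mu> + \<mu>') m = (\<Sum>j\<in>?K. Poly_Mapping.lookup (\<mu> + \<mu>') j * Poly_Mapping.lookup m j)"
    by (rule eval_form_superset) (simp_all add: Poly_Mapping.keys_add)
  also have "\<dots> = eval_form \<mu> m + eval_form \<mu>' m"
    by (simp add: lookup_add distrib_right sum.distrib eval_form_superset[of ?K])
  finally show ?thesis .
qed

lemma eval_form_bform: "eval_form (bform j) m = Poly_Mapping.lookup m j"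
  by (simp add: eval_form_def bform_def)

lemma eval_form_bform_frag_of [simp]: "eval_form (bform j) (frag_of i) = (if i = j then 1 else 0)"
  by (simp add: eval_form_bform lookup_single when_def)

lemma bvec_int [simp]: "bvec (int n) = frag_of n"
  by (simp add: bvec_def)

interpretation eval: linear_form "eval_form \<mu>" for \<mu>
  by unfold_locales (rule eval_form_add_right)

abbreviation contraction :: "M0_dual \<Rightarrow> M0 ext \<Rightarrow> M0 ext" where
  "contraction \<mu> \<equiv> interior (eval_form \<mu>)"

lemma contraction_form_add: "contraction (\<mu> + \<mu>') x = contraction \<mu> x + contraction \<mu>' x"
  using interior_form_add[OF eval.linear_form_axioms eval.linear_form_axioms, of \<mu> \<mu>' x]
  by (simp add: eval_form_add_left[abs_def])

lemmas contraction_form_diff = additive_diff[of "\<lambda>\<mu>. contraction \<mu> x" for x, OF contraction_form_add]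

fun iter_contraction :: "M0_dual list \<Rightarrow> M0 ext \<Rightarrow> M0 ext" where
  "iter_contraction [] x = x"
| "iter_contraction (\<mu> # \<mu>s) x = iter_contraction \<mu>s (contraction \<mu> x)"

lemma iter_contraction_append:
  "iter_contraction (u @ v) x = iter_contraction v (iter_contraction u x)"
  by (induction u arbitrary: x) simp_all

lemma iter_contraction_add:
  "iter_contraction u (x + y) = iter_contraction u x + iter_contraction u y"
  by (induction u arbitrary: x y) (simp_all add: eval.interior_add)

text \<open>Contracting with the forms from left to right makes contraction the adjoint of left
  multiplication by a form, which is how \<open>contract\<close> is specified. The determinant
  formula becomes a theorem.\<close>

definition ext_pair :: "M0_dual ext \<Rightarrow> M0 ext \<Rightarrow> int" where
  "ext_pair \<gamma> x = ext_lift (\<lambda>\<mu>s. augmentation (iter_contraction \<mu>s x)) \<gamma>"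

lemma iter_contraction_alternating:
  "alternating_multilinear (\<lambda>\<mu>s. augmentation (iter_contraction \<mu>s x))"
proof -
  have "iter_contraction v 0 = 0" for v
    by (induction v) simp_all
  then show ?thesis
    by (simp add: alternating_multilinear_def iter_contraction_append iter_contraction_add
        contraction_form_add augmentation_add additive_zero[of augmentation, OF augmentation_add])
qed

lemma ext_pair_wedge: "ext_pair (wedge \<mu>s) x = augmentation (iter_contraction \<mu>s x)"
  unfolding ext_pair_def by (simp add: iter_contraction_alternating)

lemma ext_pair_1 [simp]: "ext_pair 1 x = augmentation x"
  using ext_pair_wedge[of "[]"] by simp

lemma ext_pair_add_left: "ext_pair (\<gamma> + \<gamma>') x = ext_pair \<gamma> x + ext_pair \<gamma>' x"
  unfolding ext_pair_def by (rule ext_lift_add[OF iter_contraction_alternating])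

lemmas ext_pair_diff_left = additive_diff[of "\<lambda>\<gamma>. ext_pair \<gamma> x" for x, OF ext_pair_add_left]

lemma ext_pair_add_right: "ext_pair \<gamma> (x + y) = ext_pair \<gamma> x + ext_pair \<gamma> y"
  by (induction \<gamma> rule: ext_induct)
    (simp_all add: ext_pair_wedge iter_contraction_add augmentation_add ext_pair_diff_left)

lemmas ext_pair_diff_right = additive_diff[of "ext_pair \<gamma>" for \<gamma>, OF ext_pair_add_right]
lemmas ext_pair_zero_right [simp] = additive_zero[of "ext_pair \<gamma>" for \<gamma>, OF ext_pair_add_right]
lemmas ext_pair_uminus_right = additive_uminus[of "ext_pair \<gamma>" for \<gamma>, OF ext_pair_add_right]

lemma ext_pair_gen_mult: "ext_pair (ext_gen \<mu> * \<gamma>) x = ext_pair \<gamma> (contraction \<mu> x)"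
proof (induction \<gamma> rule: ext_induct)
  case (wedge \<mu>s)
  then show ?case using ext_pair_wedge[of "\<mu> # \<mu>s"] by (simp add: ext_pair_wedge)
qed (simp add: right_diff_distrib ext_pair_diff_left)

text \<open>Contracting with the first form is the Laplace expansion along the first row: dropping a
  vector deletes a column.\<close>

lemma augmentation_iter_contraction_wedge:
  "augmentation (iter_contraction \<mu>s (wedge ms)) =
    (if length \<mu>s = length ms
     then det (mat (length ms) (length ms) (\<lambda>(i, j). eval_form (\<mu>s ! i) (ms ! j)))
     else 0)"
proof (induction \<mu>s arbitrary: ms)
  case Nil
  then show ?case by (simp add: augmentation_wedge)
next
  case (Cons \<mu> \<mu>s)
  let ?f = "\<lambda>x. augmentation (iter_contraction \<mu>s x)"
  let ?del = "\<lambda>j. take j ms @ drop (Suc j) ms"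
  have add: "?f (x + y) = ?f x + ?f y" for x y
    by (simp add: iter_contraction_add augmentation_add)
  have "augmentation (iter_contraction (\<mu> # \<mu>s) (wedge ms)) =
      (\<Sum>j<length ms. (-1) ^ j * eval_form \<mu> (ms ! j) * ?f (wedge (?del j)))"
    unfolding iter_contraction.simps eval.interior_wedge_expansion
    by (subst additive_sum[of ?f, OF add], subst additive_of_int_mult[of ?f, OF add]) simp
  also have "\<dots> = (if length (\<mu> # \<mu>s) = length ms
     then det (mat (length ms) (length ms) (\<lambda>(i, j). eval_form ((\<mu> # \<mu>s) ! i) (ms ! j)))
     else 0)"
  proof (cases "length ms")
    case 0
    then show ?thesis by simp
  next
    case (Suc n)
    have len: "length (?del j) = n" if "j < length ms" for j
      using that Suc by simp
    show ?thesis
    proof (cases "length \<mu>s = n")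
      case False
      then show ?thesis using Suc len by (simp add: Cons)
    next
      case True
      let ?A = "mat (Suc n) (Suc n) (\<lambda>(i, j). eval_form ((\<mu> # \<mu>s) ! i) (ms ! j))"
      have "det ?A = (\<Sum>j<Suc n. ?A $$ (0, j) * cofactor ?A 0 j)"
        by (rule laplace_expansion_row) auto
      also have "\<dots> = (\<Sum>j<Suc n. (-1) ^ j * eval_form \<mu> (ms ! j) * ?f (wedge (?del j)))"
      proof (rule sum.cong)
        fix j assume j: "j \<in> {..<Suc n}"
        have "mat_delete ?A 0 j = mat n n (\<lambda>(i, k). eval_form (\<mu>s ! i) (?del j ! k))"
          by (rule eq_matI) (use Suc j in \<open>auto simp: mat_delete_def nth_append min_def\<close>)
        then show "?A $$ (0, j) * cofactor ?A 0 j =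
            (-1) ^ j * eval_form \<mu> (ms ! j) * ?f (wedge (?del j))"
          using True j Suc len[of j] by (simp add: Cons cofactor_def)
      qed simp
      finally show ?thesis using True Suc by simp
    qed
  qed
  finally show ?case .
qed

lemma is_ext_pairing_ext_pair: "is_ext_pairing ext_pair"
  unfolding is_ext_pairing_def
  by (simp add: ext_pair_add_left ext_pair_add_right ext_pair_wedge
      augmentation_iter_contraction_wedge)

lemma ext_pairing_eq: "ext_pairing = ext_pair"
  unfolding ext_pairing_def
proof (rule the_equality)
  fix P assume P: "is_ext_pairing P"
  have add: "P (\<gamma> + \<gamma>') x = P \<gamma> x + P \<gamma>' x" "P \<gamma> (x + x') = P \<gamma> x + P \<gamma> x'" for \<gamma> \<gamma>' x x'
    using P unfolding is_ext_pairing_def by blast+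
  have wedge: "P (wedge \<mu>s) (wedge ms) = ext_pair (wedge \<mu>s) (wedge ms)" for \<mu>s ms
    using P unfolding is_ext_pairing_def ext_pair_wedge augmentation_iter_contraction_wedge by blast
  show "P = ext_pair"
  proof (intro ext)
    fix \<gamma> x
    have "P (wedge \<mu>s) x = ext_pair (wedge \<mu>s) x" for \<mu>s
      by (rule ext_additive_eqI[of "P (wedge \<mu>s)" "ext_pair (wedge \<mu>s)"])
        (rule add ext_pair_add_right wedge)+
    from ext_additive_eqI[of "\<lambda>\<gamma>. P \<gamma> x" "\<lambda>\<gamma>. ext_pair \<gamma> x" \<gamma>, OF add(1) ext_pair_add_left this]
    show "P \<gamma> x = ext_pair \<gamma> x" .
  qed
qed (rule is_ext_pairing_ext_pair)

section \<open>Nondegeneracy\<close>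

text \<open>The subring generated by b_0, ..., b_(n-1), presented by splitting off the top
  generator. Contraction with beta_n recovers \<open>c\<close> at stage \<open>Suc n\<close>, so
  induction on the stage replaces a basis of the exterior algebra.\<close>

primrec span_below :: "nat \<Rightarrow> M0 ext set" where
  "span_below 0 = range of_int"
| "span_below (Suc n) = {a + ext_gen (frag_of n) * c | a c. a \<in> span_below n \<and> c \<in> span_below n}"

lemma span_below_SucI:
  "a \<in> span_below n \<Longrightarrow> c \<in> span_below n \<Longrightarrow> a + ext_gen (frag_of n) * c \<in> span_below (Suc n)"
  by auto

lemma span_below_of_int: "of_int k \<in> span_below n"
proof (induction n arbitrary: k)
  case (Suc n)
  show ?case using span_below_SucI[OF Suc[of k] Suc[of 0]] by simp
qed simp

lemma span_below_Suc: "x \<in> span_below n \<Longrightarrow> x \<in> span_below (Suc n)"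
  using span_below_SucI[of x n "of_int 0"] span_below_of_int[of 0 n] by simp

lemma span_below_mono: "n \<le> k \<Longrightarrow> x \<in> span_below n \<Longrightarrow> x \<in> span_below k"
  by (induction k rule: dec_induct) (use span_below_Suc in blast)+

lemma span_below_diff: "x \<in> span_below n \<Longrightarrow> y \<in> span_below n \<Longrightarrow> x - y \<in> span_below n"
proof (induction n arbitrary: x y)
  case 0
  then show ?case by (auto simp flip: of_int_diff)
next
  case (Suc n)
  then obtain a c a' c' where "x = a + ext_gen (frag_of n) * c" "y = a' + ext_gen (frag_of n) * c'"
      and *: "a \<in> span_below n" "c \<in> span_below n" "a' \<in> span_below n" "c' \<in> span_below n"
    by auto
  then have "x - y = (a - a') + ext_gen (frag_of n) * (c - c')"
    by (simp add: algebra_simps)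
  then show ?case using * Suc.IH by auto
qed

lemma span_below_gen_mult:
  "x \<in> span_below n \<Longrightarrow> k < n \<Longrightarrow> ext_gen (frag_of k) * x \<in> span_below n"
proof (induction n arbitrary: x)
  case (Suc n)
  then obtain a c where x: "x = a + ext_gen (frag_of n) * c"
      and ac: "a \<in> span_below n" "c \<in> span_below n"
    by auto
  show ?case
  proof (cases "k = n")
    case True
    then have "ext_gen (frag_of k) * x = of_int 0 + ext_gen (frag_of n) * a"
      by (simp add: x distrib_left)
    then show ?thesis using span_below_SucI[OF span_below_of_int ac(1)] by metis
  next
    case False
    then have k: "k < n" using Suc.prems by simp
    have "ext_gen (frag_of k) * x =
        ext_gen (frag_of k) * a + ext_gen (frag_of n) * (0 - ext_gen (frag_of k) * c)"
      by (simp add: x distrib_left ext_gen_anticommute_left[of "frag_of k"])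
    moreover have "0 - ext_gen (frag_of k) * c \<in> span_below n"
      using span_below_diff[OF span_below_of_int[of 0] Suc.IH[OF ac(2) k]] by simp
    ultimately show ?thesis using span_below_SucI[OF Suc.IH[OF ac(1) k]] by metis
  qed
qed simp

lemma ex_span_below: "\<exists>n. x \<in> span_below n"
proof (induction x rule: ext_induct)
  case (wedge ms)
  have gen: "\<exists>n. ext_gen v * x \<in> span_below n" if x: "\<exists>n. x \<in> span_below n" for v x
  proof (induction v rule: frag_induct)
    case zero
    show ?case using span_below_of_int[of 0] by auto
  next
    case (one k)
    obtain n where "x \<in> span_below n" using x by blast
    then have "x \<in> span_below (max n (Suc k))" by (rule span_below_mono[rotated]) simp
    then have "ext_gen (frag_of k) * x \<in> span_below (max n (Suc k))"
      by (rule span_below_gen_mult) simp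
    then show ?case by blast
  next
    case (diff v w)
    then obtain n n' where "ext_gen v * x \<in> span_below n" "ext_gen w * x \<in> span_below n'" by blast
    then have "ext_gen v * x \<in> span_below (max n n')" "ext_gen w * x \<in> span_below (max n n')"
      by (auto intro: span_below_mono[rotated])
    then show ?case using span_below_diff by (auto simp: ext_gen_diff left_diff_distrib)
  qed
  show ?case
  proof (induction ms)
    case Nil
    then show ?case using span_below_of_int[of 1] by auto
  qed (simp add: gen)
next
  case (diff x y)
  then obtain n n' where "x \<in> span_below n" "y \<in> span_below n'" by blast
  then have "x \<in> span_below (max n n')" "y \<in> span_below (max n n')"
    by (auto intro: span_below_mono[rotated])
  then show ?case using span_below_diff by blast
qed

lemma contraction_span_below: "x \<in> span_below n \<Longrightarrow> n \<le> k \<Longrightarrow> contraction (bform k) x = 0"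
proof (induction n arbitrary: x)
  case (Suc n)
  then obtain a c where "x = a + ext_gen (frag_of n) * c" "a \<in> span_below n" "c \<in> span_below n"
    by auto
  then show ?case
    using Suc by (simp add: eval.interior_add eval.interior_gen_mult)
qed auto

lemma contraction_span_below_Suc:
  assumes "a \<in> span_below n" "c \<in> span_below n"
  shows "contraction (bform n) (a + ext_gen (frag_of n) * c) = c"
  using assms by (simp add: eval.interior_add eval.interior_gen_mult contraction_span_below)

lemma finite_contraction: "finite {j. contraction (bform j) x \<noteq> 0}"
proof -
  obtain n where "x \<in> span_below n" using ex_span_below by blast
  then have "{j. contraction (bform j) x \<noteq> 0} \<subseteq> {..<n}"
    using contraction_span_below by (auto simp: not_le[symmetric])
  then show ?thesis by (rule finite_subset) simp
qed

text \<open>Contraction with the form dual to the top generator returns its coefficient, so top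
  generators are peeled off until an integer is left.\<close>

lemma contraction_zero_imp_const:
  assumes "\<And>j. contraction (bform j) x = 0"
  shows "x = of_int (augmentation x)"
proof -
  obtain n where "x \<in> span_below n" using ex_span_below by blast
  then have "x \<in> range of_int"
  proof (induction n)
    case (Suc n)
    then obtain a c where x: "x = a + ext_gen (frag_of n) * c" and "a \<in> span_below n" "c \<in> span_below n"
      by auto
    then show ?case using assms[of n] Suc contraction_span_below_Suc[of a n c] by simp
  qed simp
  then show ?thesis by auto
qed

text \<open>Contraction commutes with integer scalars, so the coefficient of the top generator is
  torsion as well and vanishes by induction; the rest lies one stage lower.\<close>

lemma ext_torsion_free:
  fixes x :: "M0 ext"
  assumes "of_int k * x = 0" "k \<noteq> 0"
  shows "x = 0"
proof -
  obtain n where "x \<in> span_below n" using ex_span_below by blast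
  then show ?thesis using assms(1)
  proof (induction n arbitrary: x)
    case 0
    then obtain c where x: "x = of_int c" by auto
    with 0 have "(of_int (k * c) :: M0 ext) = of_int 0" by simp
    then have "k * c = 0" by (metis augmentation_of_int)
    then show ?case using assms(2) x by simp
  next
    case (Suc n)
    then obtain a c where x: "x = a + ext_gen (frag_of n) * c"
        and ac: "a \<in> span_below n" "c \<in> span_below n"
      by auto
    have "of_int k * contraction (bform n) x = 0"
      using Suc.prems(2) by (simp add: eval.interior_of_int_mult[symmetric])
    then have "c = 0" using Suc.IH ac x contraction_span_below_Suc by simp
    then show ?case using Suc ac x by simp
  qed
qed

text \<open>Testing with products that start with beta_j shows, one degree lower, that every
  contraction of \<open>x\<close> with a basis form is zero; then \<open>x\<close> is an integer,
  and its positive degree makes it zero.\<close>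

lemma ext_pair_nondegenerate:
  "x \<in> ext_power r \<Longrightarrow> (\<And>\<gamma>. \<gamma> \<in> ext_power r \<Longrightarrow> ext_pair \<gamma> x = 0) \<Longrightarrow> x = 0"
proof (induction r arbitrary: x)
  case 0
  then obtain c where x: "x = of_int c" using ext_power_of_int by blast
  have "(1 :: M0_dual ext) \<in> ext_power 0" using ext_power.wedge[of "[]"] by simp
  from 0(2)[OF this] show ?case by (simp add: x)
next
  case (Suc r)
  have "contraction (bform j) x = 0" for j
    by (rule Suc.IH)
      (use Suc.prems in \<open>simp_all add: eval.interior_ext_power ext_pair_gen_mult[symmetric] ext_power_Suc\<close>)
  then have "x = of_int (augmentation x)" by (rule contraction_zero_imp_const)
  then show ?case using augmentation_ext_power[OF Suc.prems(1)] by simp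
qed

lemma contract_eq:
  assumes "r \<ge> 1" "x \<in> ext_power r"
  shows "contract r \<mu> x = contraction \<mu> x"
  unfolding contract_def ext_pairing_eq
proof (rule the_equality)
  obtain r' where r: "r = Suc r'" using assms(1) by (cases r) auto
  show *: "contraction \<mu> x \<in> ext_power (r - 1) \<and>
      (\<forall>\<gamma>\<in>ext_power (r - 1). ext_pair \<gamma> (contraction \<mu> x) = ext_pair (ext_gen \<mu> * \<gamma>) x)"
    using assms by (simp add: r eval.interior_ext_power ext_pair_gen_mult)
  fix y assume "y \<in> ext_power (r - 1) \<and>
      (\<forall>\<gamma>\<in>ext_power (r - 1). ext_pair \<gamma> y = ext_pair (ext_gen \<mu> * \<gamma>) x)"
  then have "y - contraction \<mu> x = 0"
    by (intro ext_pair_nondegenerate[of _ "r - 1"])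
      (use * in \<open>auto simp: ext_power.diff ext_pair_diff_right\<close>)
  then show "y = contraction \<mu> x" by simp
qed

section \<open>Multiplicative families of operators\<close>

lemma sum_triangle_diagonal:
  fixes f :: "nat \<Rightarrow> nat \<Rightarrow> 'a::comm_monoid_add"
  shows "(\<Sum>i\<le>n. \<Sum>a\<le>i. f a (i - a)) = (\<Sum>a\<le>n. \<Sum>j\<le>n - a. f a j)"
  unfolding sum.Sigma[OF finite_atMost ballI[OF finite_atMost]]
  by (rule sum.reindex_bij_witness[of _ "\<lambda>(a, j). (a + j, a)" "\<lambda>(i, a). (a, i - a)"]) auto

lemma sum_triangle_swap:
  fixes f :: "nat \<Rightarrow> nat \<Rightarrow> 'a::comm_monoid_add"
  shows "(\<Sum>i\<le>n. \<Sum>j\<le>n - i. f i j) = (\<Sum>j\<le>n. \<Sum>i\<le>n - j. f i j)"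
  unfolding sum.Sigma[OF finite_atMost ballI[OF finite_atMost]]
  by (rule sum.reindex_bij_witness[of _ "\<lambda>(j, i). (i, j)" "\<lambda>(i, j). (j, i)"]) auto

definition comp_family ::
  "(nat \<Rightarrow> 'a::ring_1 \<Rightarrow> 'a) \<Rightarrow> (nat \<Rightarrow> 'a \<Rightarrow> 'a) \<Rightarrow> nat \<Rightarrow> 'a \<Rightarrow> 'a" where
  "comp_family s t n x = (\<Sum>i\<le>n. s i (t (n - i) x))"

text \<open>The coefficients of a ring homomorphism into power series. Condition \<open>one\<close>
  does not follow from the other two, as the zero family shows; for Schubert series it is derived
  from the values on generators.\<close>

locale multiplicative_family =
  fixes s :: "nat \<Rightarrow> 'a::ring_1 \<Rightarrow> 'a"
  assumes add: "s n (x + y) = s n x + s n y"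
    and mult: "s n (x * y) = (\<Sum>i\<le>n. s i x * s (n - i) y)"
    and one: "s n 1 = (if n = 0 then 1 else 0)"
begin

lemmas diff = additive_diff[of "s n" for n, OF add]
lemmas zero [simp] = additive_zero[of "s n" for n, OF add]
lemmas uminus = additive_uminus[of "s n" for n, OF add]
lemmas sum = additive_sum[of "s n" for n, OF add]
lemmas of_int_mult = additive_of_int_mult[of "s n" for n, OF add]

end

lemma multiplicative_family_comp:
  assumes "multiplicative_family s" "multiplicative_family t"
  shows "multiplicative_family (comp_family s t)"
proof -
  interpret s: multiplicative_family s by fact
  interpret t: multiplicative_family t by fact
  have "comp_family s t n (x * y) = (\<Sum>k\<le>n. comp_family s t k x * comp_family s t (n - k) y)"
    for n x y
  proof -
    have "comp_family s t n (x * y) =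
        (\<Sum>i\<le>n. \<Sum>j\<le>n - i. \<Sum>k\<le>i. s k (t j x) * s (i - k) (t (n - i - j) y))"
      by (simp add: comp_family_def t.mult s.sum s.mult)
    \<comment> \<open>The new outer index is the total degree that both operators spend on
      \<open>x\<close>, which was \<open>k + j\<close> before.\<close>
    also have "\<dots> = (\<Sum>k\<le>n. \<Sum>i\<le>k. \<Sum>j\<le>n - k. s i (t (k - i) x) * s j (t (n - k - j) y))"
      unfolding sum.Sigma[OF finite_atMost ballI[OF finite_atMost]]
        sum.Sigma[OF finite_atMost ballI[OF finite_SigmaI[OF finite_atMost finite_atMost]]]
      by (rule sum.reindex_bij_witness[of _ "\<lambda>(k, i, j). (i + j, k - i, i)"
            "\<lambda>(i, j, k). (k + j, k, i - k)"]) (auto simp: add.commute)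
    also have "\<dots> = (\<Sum>k\<le>n. comp_family s t k x * comp_family s t (n - k) y)"
      by (simp add: comp_family_def sum_product)
    finally show ?thesis .
  qed
  moreover have "comp_family s t n 1 = (if n = 0 then 1 else 0)" for n
  proof -
    have "comp_family s t n 1 = (\<Sum>i\<le>n. if i = n then s n 1 else 0)"
      unfolding comp_family_def by (rule sum.cong) (auto simp: t.one)
    then show ?thesis by (simp add: s.one)
  qed
  ultimately show ?thesis
    by (simp add: multiplicative_family_def comp_family_def s.add t.add sum.distrib)
qed

lemma multiplicative_family_id: "multiplicative_family (\<lambda>n x. if n = 0 then x else 0)"
proof -
  have "(\<Sum>i\<le>n. (if i = 0 then x else 0) * (if n - i = 0 then y else 0)) =
      (if n = 0 then x * y else 0)" for n :: nat and x y :: 'a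
  proof (cases n)
    case (Suc k)
    then have "(if i = 0 then x else 0) * (if n - i = 0 then y else 0) = 0" for i by simp
    then show ?thesis using Suc by simp
  qed simp
  then show ?thesis by (simp add: multiplicative_family_def)
qed

lemma multiplicative_family_unique:
  fixes s t :: "nat \<Rightarrow> 'm::ab_group_add ext \<Rightarrow> 'm ext"
  assumes "multiplicative_family s" "multiplicative_family t"
    and gen: "\<And>n m. s n (ext_gen m) = t n (ext_gen m)"
  shows "s = t"
proof (intro ext)
  interpret s: multiplicative_family s by fact
  interpret t: multiplicative_family t by fact
  fix n x
  show "s n x = t n x"
  proof (induction x arbitrary: n rule: ext_induct)
    case (wedge ms)
    show ?case by (induction ms arbitrary: n) (simp_all add: s.one t.one s.mult t.mult gen)
  qed (simp add: s.diff t.diff)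
qed

text \<open>Coefficient form of s(z)(y t(z) x) = (s(z) y)(s(z) t(z) x) = (s(z) y) x.\<close>

lemma family_inverse_mult:
  assumes "multiplicative_family s" and "\<And>n x. comp_family s t n x = (if n = 0 then x else 0)"
  shows "(\<Sum>i\<le>n. s i (y * t (n - i) x)) = s n y * x"
proof -
  interpret s: multiplicative_family s by fact
  have "(\<Sum>i\<le>n. s i (y * t (n - i) x)) = (\<Sum>i\<le>n. \<Sum>a\<le>i. s a y * s (i - a) (t (n - a - (i - a)) x))"
    by (simp add: s.mult)
  also have "\<dots> = (\<Sum>a\<le>n. s a y * comp_family s t (n - a) x)"
    unfolding sum_triangle_diagonal[of "\<lambda>a j. s a y * s j (t (n - a - j) x)"]
    by (simp add: comp_family_def sum_distrib_left)
  also have "\<dots> = (\<Sum>a\<le>n. if a = n then s n y * x else 0)"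
    by (rule sum.cong) (auto simp: assms)
  finally show ?thesis by simp
qed

text \<open>Coefficient form of t(z) s(z) y(z) = y(z), where the argument y(z) is itself a power
  series.\<close>

lemma family_inverse_convolution:
  assumes "\<And>n x y. t n (x + y) = t n x + t n y"
    and "\<And>n x. comp_family t s n x = (if n = 0 then x else 0)"
  shows "(\<Sum>l\<le>n. t l (\<Sum>j\<le>n - l. s (n - l - j) (y j))) = y n"
proof -
  have "(\<Sum>l\<le>n. t l (\<Sum>j\<le>n - l. s (n - l - j) (y j))) =
      (\<Sum>l\<le>n. \<Sum>j\<le>n - l. t l (s (n - j - l) (y j)))"
    by (simp add: additive_sum[of "t l" for l, OF assms(1)] add.commute)
  also have "\<dots> = (\<Sum>j\<le>n. comp_family t s (n - j) (y j))"
    unfolding sum_triangle_swap[of "\<lambda>l j. t l (s (n - j - l) (y j))"] by (simp add: comp_family_def)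
  also have "\<dots> = (\<Sum>j\<le>n. if j = n then y n else 0)"
    by (rule sum.cong) (auto simp: assms)
  finally show ?thesis by simp
qed

section \<open>Extending a sequence of additive maps of \<open>M0\<close> to the exterior
  algebra\<close>

text \<open>Multiplication of power series over the exterior algebra encodes the product rule for
  all coefficients at once; a vector m is sent to the series of the a_i(m). The universal property
  applies once these series square to zero.\<close>

definition series_of_maps :: "(nat \<Rightarrow> M0 \<Rightarrow> M0) \<Rightarrow> M0 list \<Rightarrow> M0 ext fps" where
  "series_of_maps a ms = prod_list (map (\<lambda>m. Abs_fps (\<lambda>i. ext_gen (a i m))) ms)"

definition family_of_maps :: "(nat \<Rightarrow> M0 \<Rightarrow> M0) \<Rightarrow> nat \<Rightarrow> M0 ext \<Rightarrow> M0 ext" where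
  "family_of_maps a n x = fps_nth (ext_lift (series_of_maps a) x) n"

locale additive_maps =
  fixes a :: "nat \<Rightarrow> M0 \<Rightarrow> M0"
  assumes maps_add: "a i (m + m') = a i m + a i m'"
begin

lemma series_sq: "Abs_fps (\<lambda>i. ext_gen (a i m)) * Abs_fps (\<lambda>i. ext_gen (a i m)) = 0"
proof (rule fps_ext)
  fix n
  let ?S = "\<Sum>i\<le>n. ext_gen (a i m) * ext_gen (a (n - i) m)"
  \<comment> \<open>Reversing the order and anticommuting gives \<open>?S = - ?S\<close>; cancelling
    2 by torsion-freeness avoids a separate treatment of the middle term.\<close>
  have "?S = (\<Sum>i\<le>n. ext_gen (a (n - i) m) * ext_gen (a i m))"
    by (rule sum.reindex_bij_witness[of _ "\<lambda>i. n - i" "\<lambda>i. n - i"]) auto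
  also have "\<dots> = (\<Sum>i\<le>n. - (ext_gen (a i m) * ext_gen (a (n - i) m)))"
    by (rule sum.cong[OF refl]) (rule ext_gen_anticommute)
  also have "\<dots> = - ?S" by (simp add: sum_negf)
  finally have "?S + ?S = 0" by (simp only: eq_neg_iff_add_eq_0)
  then have "of_int 2 * ?S = 0" by (simp only: of_int_numeral mult_2)
  then have "?S = 0" by (rule ext_torsion_free) simp
  then show "fps_nth (Abs_fps (\<lambda>i. ext_gen (a i m)) * Abs_fps (\<lambda>i. ext_gen (a i m))) n = fps_nth 0 n"
    by (simp add: fps_mult_nth atLeast0AtMost)
qed

lemma series_add: "Abs_fps (\<lambda>i. ext_gen (a i (m + m'))) =
    Abs_fps (\<lambda>i. ext_gen (a i m)) + Abs_fps (\<lambda>i. ext_gen (a i m'))"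
  by (rule fps_ext) (simp add: maps_add ext_gen_add)

lemma series_alternating: "alternating_multilinear (series_of_maps a)"
  unfolding alternating_multilinear_def
proof (intro conjI allI)
  fix u v m m'
  show "series_of_maps a (u @ (m + m') # v) = series_of_maps a (u @ m # v) + series_of_maps a (u @ m' # v)"
    by (simp add: series_of_maps_def series_add distrib_left distrib_right)
  show "series_of_maps a (u @ m # m # v) = 0"
    by (simp add: series_of_maps_def) (simp add: mult.assoc[symmetric] series_sq)
qed

lemma lift_mult:
  "ext_lift (series_of_maps a) (x * y) = ext_lift (series_of_maps a) x * ext_lift (series_of_maps a) y"
proof (induction x rule: ext_induct)
  case (wedge ms)
  show ?case
  proof (induction y rule: ext_induct)
    case (wedge ms')
    have "ext_lift (series_of_maps a) (wedge (ms @ ms')) =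
        ext_lift (series_of_maps a) (wedge ms) * ext_lift (series_of_maps a) (wedge ms')"
      unfolding ext_lift_wedge[OF series_alternating] by (simp add: series_of_maps_def)
    then show ?case by (simp only: wedge_append)
  qed (simp add: right_diff_distrib additive_diff[of "ext_lift (series_of_maps a)"]
      ext_lift_add series_alternating)
qed (simp add: left_diff_distrib additive_diff[of "ext_lift (series_of_maps a)"]
    ext_lift_add series_alternating)

lemma family_of_maps_gen: "family_of_maps a n (ext_gen m) = ext_gen (a n m)"
  using ext_lift_wedge[OF series_alternating, of "[m]"]
  by (simp add: family_of_maps_def series_of_maps_def)

lemma multiplicative_family_of_maps: "multiplicative_family (family_of_maps a)"
  using ext_lift_wedge[OF series_alternating, of "[]"]
  by (simp add: multiplicative_family_def family_of_maps_def lift_mult fps_mult_nth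
      ext_lift_add series_alternating atLeast0AtMost series_of_maps_def)

end

lemma multiplicative_family_ext_power:
  fixes s :: "nat \<Rightarrow> 'm::ab_group_add ext \<Rightarrow> 'm ext"
  assumes "multiplicative_family s" and gen: "\<And>n m. \<exists>m'. s n (ext_gen m) = ext_gen m'"
    and "x \<in> ext_power r"
  shows "s n x \<in> ext_power r"
proof -
  interpret s: multiplicative_family s by fact
  from assms(3) show ?thesis
  proof (induction arbitrary: n rule: ext_power.induct)
    case (wedge ms)
    then show ?case
    proof (induction ms arbitrary: n r)
      case Nil
      have "(1 :: 'm ext) \<in> ext_power 0" using ext_power.wedge[of "[]"] by simp
      then show ?case using Nil by (simp add: s.one)
    next
      case (Cons m ms)
      have "s i (ext_gen m) * s (n - i) (wedge ms) \<in> ext_power r" for i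
        using gen[of i m] Cons.IH[OF refl, of "n - i"] ext_power_Suc Cons.prems by fastforce
      then show ?case by (simp add: s.mult ext_power_sum)
    qed
  qed (simp add: s.diff ext_power.diff)
qed

section \<open>Schubert derivations\<close>

definition shift :: "int \<Rightarrow> nat \<Rightarrow> M0 \<Rightarrow> M0" where
  "shift \<epsilon> i = frag_extend (\<lambda>j. bvec (int j + \<epsilon> * int i))"

lemma shift_add: "shift \<epsilon> i (v + w) = shift \<epsilon> i v + shift \<epsilon> i w"
  by (simp add: shift_def frag_extend_add)

lemma shift_diff: "shift \<epsilon> i (v - w) = shift \<epsilon> i v - shift \<epsilon> i w"
  by (simp add: shift_def frag_extend_diff)

lemmas shift_uminus = additive_uminus[of "shift \<epsilon> i" for \<epsilon> i, OF shift_add]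

lemma shift_zero [simp]: "shift \<epsilon> i 0 = 0"
  by (simp add: shift_def)

lemma shift_frag_of [simp]: "shift \<epsilon> i (frag_of j) = bvec (int j + \<epsilon> * int i)"
  by (simp add: shift_def)

lemma shift_0 [simp]: "shift \<epsilon> 0 v = v"
  by (induction v rule: frag_induct) (simp_all add: shift_diff)

lemma shift_bvec: "shift \<epsilon> i (bvec k) = (if k < 0 then 0 else bvec (k + \<epsilon> * int i))"
proof (cases "k < 0")
  case False
  then obtain j where "k = int j" by (metis nonneg_int_cases not_less)
  then show ?thesis by simp
qed (simp add: bvec_def)

lemma shift_shift: "shift \<epsilon> i (shift \<epsilon> j v) = shift \<epsilon> (i + j) v"
proof (induction v rule: frag_induct)
  case (one k)
  \<comment> \<open>A negative intermediate index forces \<open>\<epsilon> < 0\<close>, so the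
    remaining shift cannot bring it back to a basis vector.\<close>
  have "bvec (int k + \<epsilon> * int (i + j)) = 0" if neg: "int k + \<epsilon> * int j < 0"
  proof -
    have "\<epsilon> * int j < 0" using neg by linarith
    then have "\<epsilon> * int i \<le> 0" by (simp add: mult_less_0_iff mult_le_0_iff)
    then show ?thesis using neg by (simp add: bvec_def algebra_simps)
  qed
  then show ?case by (auto simp: shift_bvec algebra_simps)
qed (simp_all add: shift_diff)

interpretation shift: additive_maps "shift \<epsilon>" for \<epsilon>
  by unfold_locales (rule shift_add)

lemma is_schubertD:
  assumes "is_schubert \<epsilon> s"
  shows "multiplicative_family s" and "s n (ext_gen v) = ext_gen (shift \<epsilon> n v)"
proof -
  have add: "s n (x + y) = s n x + s n y" and mult: "s n (x * y) = (\<Sum>i\<le>n. s i x * s (n - i) y)"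
    and gen: "s i (ext_gen (bvec (int j))) = ext_gen (bvec (int j + \<epsilon> * int i))" for n x y i j
    using assms unfolding is_schubert_def by blast+
  have one0: "s 0 1 = 1"
  proof -
    \<comment> \<open>For such \<open>n\<close>, the generator b_n is fixed by \<open>s 0\<close>,
      hence annihilates \<open>s 0 1 - 1\<close>; since b_n lies beyond that element, contraction
      with beta_n recovers it.\<close>
    obtain n where n: "s 0 1 - 1 \<in> span_below n" using ex_span_below by blast
    have "ext_gen (frag_of n) * (s 0 1 - 1) = 0"
      using mult[of 0 "ext_gen (frag_of n)" 1] gen[of 0 n] by (simp add: right_diff_distrib)
    then have "contraction (bform n) (of_int 0 + ext_gen (frag_of n) * (s 0 1 - 1)) = 0"
      by simp
    then show ?thesis
      using contraction_span_below_Suc[OF span_below_of_int n, of 0] by simp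
  qed
  have "s n 1 = 0" if "n > 0" for n
    using that
  proof (induction n rule: less_induct)
    case (less n)
    \<comment> \<open>By induction only the two outer terms survive, so \<open>s n 1\<close> equals
      its own double.\<close>
    have "s n 1 = (\<Sum>i\<le>n. s i 1 * s (n - i) 1)"
      using mult[of n 1 1] by simp
    also have "\<dots> = (\<Sum>i\<le>n. (if i = 0 then s n 1 else 0) + (if i = n then s n 1 else 0))"
      by (rule sum.cong) (use less in \<open>auto simp: one0\<close>)
    finally have "s n 1 = s n 1 + s n 1" by (simp add: sum.distrib)
    then show ?case by simp
  qed
  then show "multiplicative_family s"
    using add mult one0 by (simp add: multiplicative_family_def)
  show "s n (ext_gen v) = ext_gen (shift \<epsilon> n v)"
  proof (induction v rule: frag_induct)
    case (one j)
    then show ?case using gen[of n j] by simp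
  qed (simp_all add: shift_diff ext_gen_diff additive_diff[of "s n"] additive_zero[of "s n"] add)
qed

lemma is_schubert_family: "is_schubert \<epsilon> (family_of_maps (shift \<epsilon>))"
  using shift.multiplicative_family_of_maps[of \<epsilon>]
  by (simp add: is_schubert_def multiplicative_family_def shift.family_of_maps_gen)

lemma is_schubert_schubert: "is_schubert \<epsilon> (schubert \<epsilon>)"
  unfolding schubert_def
proof (rule theI[of _ "family_of_maps (shift \<epsilon>)"])
  fix s assume "is_schubert \<epsilon> s"
  from is_schubertD[OF this] is_schubertD[OF is_schubert_family]
  show "s = family_of_maps (shift \<epsilon>)" by (intro multiplicative_family_unique) auto
qed (rule is_schubert_family)

lemmas multiplicative_family_schubert = is_schubertD(1)[OF is_schubert_schubert]
lemmas schubert_gen [simp] = is_schubertD(2)[OF is_schubert_schubert]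

interpretation schubert: multiplicative_family "schubert \<epsilon>" for \<epsilon>
  by (rule multiplicative_family_schubert)

section \<open>The inverse Schubert series\<close>

text \<open>Coefficients of 1 - S z with S = \<open>shift \<epsilon> 1\<close>, the inverse of the
  geometric series of S z.\<close>

definition inverse_shift :: "int \<Rightarrow> nat \<Rightarrow> M0 \<Rightarrow> M0" where
  "inverse_shift \<epsilon> i v = (if i = 0 then v else if i = 1 then - shift \<epsilon> 1 v else 0)"

interpretation inverse_shift: additive_maps "inverse_shift \<epsilon>" for \<epsilon>
  by unfold_locales (simp add: inverse_shift_def shift_add)

lemma sum_first_two_terms:
  fixes n :: nat and x y :: "'a::comm_monoid_add"
  assumes "\<And>i. i \<le> n \<Longrightarrow> g i = (if i = 0 then x else if i = 1 then y else 0)"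
  shows "(\<Sum>i\<le>n. g i) = (if n = 0 then x else x + y)"
proof -
  have "(\<Sum>i\<le>n. g i) = (\<Sum>i\<le>n. (if i = 0 then x else 0) + (if i = 1 then y else 0))"
    by (rule sum.cong) (auto simp: assms)
  then show ?thesis by (auto simp: sum.distrib)
qed

text \<open>Both compositions are multiplicative families, so they are compared with the identity
  family on vectors only, where the two shifts of total size n cancel.\<close>

lemma comp_inverse:
  "comp_family (schubert \<epsilon>) (family_of_maps (inverse_shift \<epsilon>)) = (\<lambda>n x. if n = 0 then x else 0)"
  "comp_family (family_of_maps (inverse_shift \<epsilon>)) (schubert \<epsilon>) = (\<lambda>n x. if n = 0 then x else 0)"
proof -
  let ?t = "family_of_maps (inverse_shift \<epsilon>)"
  have left: "comp_family ?t (schubert \<epsilon>) n (ext_gen v) = (if n = 0 then ext_gen v else 0)" for n v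
  proof -
    have "(\<Sum>i\<le>n. ?t i (schubert \<epsilon> (n - i) (ext_gen v))) =
        (if n = 0 then ext_gen (shift \<epsilon> n v)
         else ext_gen (shift \<epsilon> n v) + - ext_gen (shift \<epsilon> n v))"
      by (rule sum_first_two_terms)
        (auto simp: inverse_shift.family_of_maps_gen inverse_shift_def shift_shift ext_gen_uminus)
    then show ?thesis by (simp add: comp_family_def)
  qed
  have "comp_family (schubert \<epsilon>) ?t n (ext_gen v) = (if n = 0 then ext_gen v else 0)" for n v
  proof -
    have "comp_family (schubert \<epsilon>) ?t n (ext_gen v) = (\<Sum>i\<le>n. schubert \<epsilon> (n - i) (?t i (ext_gen v)))"
      unfolding comp_family_def
      by (rule sum.reindex_bij_witness[of _ "\<lambda>i. n - i" "\<lambda>i. n - i"]) auto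
    also have "\<dots> = (if n = 0 then ext_gen (shift \<epsilon> n v)
         else ext_gen (shift \<epsilon> n v) + - ext_gen (shift \<epsilon> n v))"
      by (rule sum_first_two_terms)
        (auto simp: inverse_shift.family_of_maps_gen inverse_shift_def shift_shift shift_uminus ext_gen_uminus)
    finally show ?thesis by simp
  qed
  with left show "comp_family (schubert \<epsilon>) ?t = (\<lambda>n x. if n = 0 then x else 0)"
    "comp_family ?t (schubert \<epsilon>) = (\<lambda>n x. if n = 0 then x else 0)"
    by (auto intro!: multiplicative_family_unique multiplicative_family_comp
        multiplicative_family_schubert multiplicative_family_id
        inverse_shift.multiplicative_family_of_maps)
qed

interpretation inv: multiplicative_family "family_of_maps (inverse_shift \<epsilon>)" for \<epsilon>
  by (rule inverse_shift.multiplicative_family_of_maps)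

lemma is_series_inverse_family:
  "is_series_inverse (schubert \<epsilon>) (family_of_maps (inverse_shift \<epsilon>))"
  using comp_inverse[of \<epsilon>] by (simp add: is_series_inverse_def fun_eq_iff comp_family_def inv.add)

lemma schubert_inv_eq: "schubert_inv \<epsilon> = family_of_maps (inverse_shift \<epsilon>)"
  unfolding schubert_inv_def
proof (rule the_equality)
  let ?s = "schubert \<epsilon>" and ?u = "family_of_maps (inverse_shift \<epsilon>)"
  fix t assume "is_series_inverse ?s t"
  then have t: "comp_family ?s t n x = (if n = 0 then x else 0)" for n x
    by (simp add: is_series_inverse_def comp_family_def)
  have "t n x = ?u n x" for n x
  proof -
    \<comment> \<open>Uniqueness by computing u(z) s(z) t(z) x in two ways: \<open>conv\<close>
      cancels u(z) s(z), and \<open>inner\<close> cancels s(z) t(z).\<close>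
    have conv: "(\<Sum>l\<le>n. ?u l (\<Sum>j\<le>n - l. ?s (n - l - j) (t j x))) = t n x"
      by (rule family_inverse_convolution) (simp_all add: inv.add comp_inverse)
    have inner: "(\<Sum>j\<le>k. ?s (k - j) (t j x)) = (if k = 0 then x else 0)" for k
      unfolding t[symmetric] comp_family_def
      by (rule sum.reindex_bij_witness[of _ "\<lambda>i. k - i" "\<lambda>i. k - i"]) auto
    have "(\<Sum>l\<le>n. ?u l (if n - l = 0 then x else 0)) = (\<Sum>l\<le>n. if l = n then ?u n x else 0)"
      by (rule sum.cong) auto
    then show ?thesis using conv unfolding inner by simp
  qed
  then show "t = ?u" by blast
qed (rule is_series_inverse_family)

lemmas multiplicative_family_schubert_inv =
  inverse_shift.multiplicative_family_of_maps[folded schubert_inv_eq]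

interpretation schubert_inv: multiplicative_family "schubert_inv \<epsilon>" for \<epsilon>
  by (rule multiplicative_family_schubert_inv)

lemmas schubert_inv_right = comp_inverse(1)[folded schubert_inv_eq]
lemmas schubert_inv_left = comp_inverse(2)[folded schubert_inv_eq]
lemmas schubert_inv_gen = inverse_shift.family_of_maps_gen[folded schubert_inv_eq]

lemma schubert_ext_power: "x \<in> ext_power r \<Longrightarrow> schubert \<epsilon> n x \<in> ext_power r"
  by (rule multiplicative_family_ext_power[OF multiplicative_family_schubert]) auto

lemma schubert_inv_gen_mult:
  "schubert_inv \<epsilon> 0 (ext_gen v * x) = ext_gen v * schubert_inv \<epsilon> 0 x"
  "schubert_inv \<epsilon> (Suc n) (ext_gen v * x) =
    ext_gen v * schubert_inv \<epsilon> (Suc n) x - ext_gen (shift \<epsilon> 1 v) * schubert_inv \<epsilon> n x"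
proof -
  show "schubert_inv \<epsilon> 0 (ext_gen v * x) = ext_gen v * schubert_inv \<epsilon> 0 x"
    by (simp add: schubert_inv.mult schubert_inv_gen inverse_shift_def)
  show "schubert_inv \<epsilon> (Suc n) (ext_gen v * x) =
    ext_gen v * schubert_inv \<epsilon> (Suc n) x - ext_gen (shift \<epsilon> 1 v) * schubert_inv \<epsilon> n x"
    unfolding schubert_inv.mult
    by (subst sum_first_two_terms[where x = "ext_gen v * schubert_inv \<epsilon> (Suc n) x"
          and y = "- ext_gen (shift \<epsilon> 1 v) * schubert_inv \<epsilon> n x"])
      (auto simp: schubert_inv_gen inverse_shift_def ext_gen_uminus)
qed

lemma schubert_inv_0 [simp]: "schubert_inv \<epsilon> 0 x = x"
proof (induction x rule: ext_induct)
  case (wedge ms)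
  show ?case by (induction ms) (simp_all add: schubert_inv.one schubert_inv_gen_mult)
qed (simp add: schubert_inv.diff)

text \<open>Each factor v - z S v contributes degree at most one in z.\<close>

lemma schubert_inv_wedge_vanish: "length ms < n \<Longrightarrow> schubert_inv \<epsilon> n (wedge ms) = 0"
proof (induction ms arbitrary: n)
  case Nil
  then show ?case by (simp add: schubert_inv.one)
next
  case (Cons m ms)
  then show ?case by (cases n) (simp_all add: schubert_inv_gen_mult(2))
qed

lemma schubert_inv_vanish: "x \<in> ext_power r \<Longrightarrow> r < n \<Longrightarrow> schubert_inv \<epsilon> n x = 0"
  by (induction rule: ext_power.induct) (simp_all add: schubert_inv_wedge_vanish schubert_inv.diff)

text \<open>Put S = \<open>shift \<epsilon> 1\<close> and let l be the number of vectors. The top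
  coefficient is the product of the -S v. The opposite series, with variable w, turns -S v into w v
  - S v because the hypothesis lets it undo S. The coefficient of w^k in the product of these is
  that of z^(l-k) in the product of the v - z S v.\<close>

lemma schubert_inv_opposite_wedge:
  assumes "\<And>v. v \<in> set ms \<Longrightarrow> shift (- \<epsilon>) 1 (shift \<epsilon> 1 v) = v"
  shows "schubert_inv (- \<epsilon>) k (schubert_inv \<epsilon> (length ms) (wedge ms)) =
    (if k \<le> length ms then schubert_inv \<epsilon> (length ms - k) (wedge ms) else 0)"
  using assms
proof (induction ms arbitrary: k)
  case Nil
  then show ?case by (simp add: schubert_inv.one)
next
  case (Cons v ms)
  let ?l = "length ms"
  have top: "schubert_inv \<epsilon> (Suc ?l) (ext_gen v * wedge ms) =
      - (ext_gen (shift \<epsilon> 1 v) * schubert_inv \<epsilon> ?l (wedge ms))"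
    by (simp only: schubert_inv_gen_mult(2) schubert_inv_wedge_vanish[OF lessI]) simp
  show ?case
  proof (cases k)
    case (Suc k')
    have IH: "schubert_inv (- \<epsilon>) k (schubert_inv \<epsilon> ?l (wedge ms)) =
        (if k \<le> ?l then schubert_inv \<epsilon> (?l - k) (wedge ms) else 0)" for k
      using Cons by simp
    have "schubert_inv (- \<epsilon>) (Suc k') (schubert_inv \<epsilon> (Suc ?l) (ext_gen v * wedge ms)) =
        - schubert_inv (- \<epsilon>) (Suc k') (ext_gen (shift \<epsilon> 1 v) * schubert_inv \<epsilon> ?l (wedge ms))"
      by (simp only: top schubert_inv.uminus)
    also have "\<dots> = ext_gen v * (if k' \<le> ?l then schubert_inv \<epsilon> (?l - k') (wedge ms) else 0) -
        ext_gen (shift \<epsilon> 1 v) *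
          (if Suc k' \<le> ?l then schubert_inv \<epsilon> (?l - Suc k') (wedge ms) else 0)"
      unfolding schubert_inv_gen_mult(2) IH
      using Cons.prems[of v] by simp
    also have "\<dots> = (if k' \<le> ?l then schubert_inv \<epsilon> (?l - k') (ext_gen v * wedge ms) else 0)"
    \<comment> \<open>Below \<open>?l\<close> the two terms recombine by the product rule; at
      \<open>k' = ?l\<close> only the coefficient of degree zero is left, and it has no second
      term.\<close>
    proof (cases "k' < ?l")
      case True
      then obtain d where d: "?l - k' = Suc d" "?l - Suc k' = d" by (metis Suc_diff_Suc)
      show ?thesis unfolding d schubert_inv_gen_mult(2) using True by simp
    next
      case False
      then show ?thesis by (cases "k' = ?l") simp_all
    qed
    finally show ?thesis using Suc by simp
  qed simp
qed

section \<open>The two factors of the residue\<close>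

text \<open>\<open>single_one\<close> would turn \<open>b\<^sub>0\<close> into the unit of the convolution product.\<close>

declare single_one [simp del]

lemma ext_gen_cmul: "ext_gen (frag_cmul c v) = of_int c * ext_gen v"
proof (induction c rule: int_induct[of _ 0])
  case (step1 i)
  then show ?case by (simp add: frag_cmul_distrib ext_gen_add distrib_right)
next
  case (step2 i)
  then show ?case by (simp add: frag_cmul_diff_distrib ext_gen_diff left_diff_distrib)
qed simp

lemma shift_up_down: "shift (- 1) (Suc 0) (shift 1 (Suc 0) v) = v"
  by (induction v rule: frag_induct) (simp_all add: shift_diff shift_bvec)

lemma shift_down_up: "shift 1 (Suc 0) (shift (- 1) (Suc 0) v) = v - frag_cmul (Poly_Mapping.lookup v 0) (frag_of 0)"
proof (induction v rule: frag_induct)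
  case (one j)
  show ?case
  proof (cases j)
    case 0
    then show ?thesis by (simp add: shift_bvec)
  next
    case (Suc k)
    have "bvec (int k + 1) = frag_of (Suc k)"
      using bvec_int[of "Suc k"] by (simp add: add.commute del: bvec_int)
    then show ?thesis using Suc by (simp add: lookup_single)
  qed
qed (simp_all add: shift_diff lookup_minus frag_cmul_diff_distrib)

text \<open>By \<open>shift_down_up\<close> the condition on \<open>v\<close> means a zero
  coordinate at b_0, phrased as the exchange rule for opposite series consumes it.\<close>

inductive_set shifted_power :: "nat \<Rightarrow> M0 ext set" for r where
  wedge: "length ms = r \<Longrightarrow> (\<And>v. v \<in> set ms \<Longrightarrow> shift 1 (Suc 0) (shift (- 1) (Suc 0) v) = v) \<Longrightarrow>
    wedge ms \<in> shifted_power r"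
| diff: "x \<in> shifted_power r \<Longrightarrow> y \<in> shifted_power r \<Longrightarrow> x - y \<in> shifted_power r"

text \<open>The projection away from b_0, extended multiplicatively. As b_0 squares to zero, the
  only correction is the part containing b_0 once.\<close>

lemma wedge_shift_down_up:
  "wedge (map (\<lambda>v. shift 1 (Suc 0) (shift (- 1) (Suc 0) v)) ms) =
    wedge ms - ext_gen (frag_of 0) * contraction (bform 0) (wedge ms)"
proof (induction ms)
  case (Cons v ms)
  have form: "eval_form (bform 0) v = Poly_Mapping.lookup v 0"
    by (rule eval_form_bform)
  show ?case
    unfolding list.map wedge_Cons Cons
    unfolding shift_down_up ext_gen_diff ext_gen_cmul eval.interior_gen_mult form
    by (simp add: algebra_simps
        ext_gen_anticommute_left[of v "frag_of 0"] of_int_gen_mult)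
qed simp

text \<open>The projection away from b_0 maps into \<open>shifted_power\<close>, and it fixes the
  elements killed by beta_0.\<close>

lemma kernel_shifted_power:
  assumes "x \<in> ext_power r" "contraction (bform 0) x = 0"
  shows "x \<in> shifted_power r"
proof -
  from assms(1) have "x - ext_gen (frag_of 0) * contraction (bform 0) x \<in> shifted_power r"
  proof (induction rule: ext_power.induct)
    case (wedge ms)
    show ?case
      unfolding wedge_shift_down_up[symmetric]
      by (rule shifted_power.wedge) (use wedge shift_up_down in auto)
  next
    case (diff x y)
    from shifted_power.diff[OF diff.IH] show ?case
      by (simp add: eval.interior_diff algebra_simps)
  qed
  then show ?thesis by (simp add: assms(2))
qed

lemma schubert_inv_opposite_up:
  "x \<in> ext_power r \<Longrightarrow> schubert_inv (- 1) k (schubert_inv 1 r x) =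
    (if k \<le> r then schubert_inv 1 (r - k) x else 0)"
proof (induction rule: ext_power.induct)
  case (wedge ms)
  then show ?case
    using schubert_inv_opposite_wedge[of ms 1 k] shift_up_down by simp
qed (simp add: schubert_inv.diff)

lemma schubert_inv_opposite_down:
  "x \<in> shifted_power r \<Longrightarrow> schubert_inv 1 k (schubert_inv (- 1) r x) =
    (if k \<le> r then schubert_inv (- 1) (r - k) x else 0)"
proof (induction rule: shifted_power.induct)
  case (wedge ms)
  then show ?case
    using schubert_inv_opposite_wedge[of ms "- 1" k] by simp
qed (simp add: schubert_inv.diff)

lemma shift_down_lookup: "eval_form (bform 0) (shift (- 1) i v) = eval_form (bform i) v"
proof (induction v rule: frag_induct)
  case (one j)
  show ?case
  proof (cases "i \<le> j")
    case True
    then have "bvec (int j - int i) = frag_of (j - i)"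
      using bvec_int[of "j - i"] by (simp add: of_nat_diff)
    then show ?thesis using True by simp
  next
    case False
    then show ?thesis by (simp add: bvec_def) (simp add: eval_form_bform)
  qed
qed (simp_all add: shift_diff additive_diff[of "eval_form \<mu>" for \<mu>, OF eval.add]
    additive_zero[of "eval_form \<mu>" for \<mu>, OF eval.add])

text \<open>On vectors, beta_0 after a down-shift by i is beta_i (\<open>shift_down_lookup\<close>).
  In the expansion of a product the scalar terms agree for this reason, and the double sums agree
  after exchanging indices.\<close>

lemma contraction_schubert:
  "contraction (bform 0) (schubert (- 1) k x) =
    (\<Sum>j\<le>k. schubert (- 1) (k - j) (contraction (bform j) x))"
proof (induction x arbitrary: k rule: ext_induct)
  case (wedge ms)
  show ?case
  proof (induction ms arbitrary: k)
    case Nil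
    then show ?case by (simp add: schubert.one)
  next
    case (Cons v ms)
    let ?s = "schubert (- 1)" and ?C = "\<lambda>j. contraction (bform j)" and ?y = "wedge ms"
    let ?v = "\<lambda>a. ext_gen (shift (- 1) a v)"
    have "?C 0 (?s k (ext_gen v * ?y)) =
        (\<Sum>a\<le>k. of_int (eval_form (bform a) v) * ?s (k - a) ?y) -
        (\<Sum>a\<le>k. \<Sum>j\<le>k - a. ?v a * ?s (k - a - j) (?C j ?y))"
      by (simp add: schubert.mult eval.interior_sum eval.interior_gen_mult Cons shift_down_lookup
          sum_subtractf sum_distrib_left)
    also have "(\<Sum>a\<le>k. \<Sum>j\<le>k - a. ?v a * ?s (k - a - j) (?C j ?y)) =
        (\<Sum>j\<le>k. \<Sum>a\<le>k - j. ?v a * ?s (k - j - a) (?C j ?y))"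
      unfolding sum_triangle_swap[of "\<lambda>a j. ?v a * ?s (k - a - j) (?C j ?y)"]
      by (simp add: add.commute)
    also have "(\<Sum>a\<le>k. of_int (eval_form (bform a) v) * ?s (k - a) ?y) - \<dots> =
        (\<Sum>j\<le>k. ?s (k - j) (?C j (ext_gen v * ?y)))"
      by (simp only: eval.interior_gen_mult schubert.diff schubert.of_int_mult sum_subtractf)
        (simp add: schubert.mult)
    finally show ?case by simp
  qed
qed (simp add: schubert.diff eval.interior_diff sum_subtractf)

section \<open>Laurent coefficients of the two factors\<close>

lemma series_apply_const:
  assumes "\<And>i. s i 0 = 0"
  shows "series_apply (- 1) s (laurent_const x) n = (if n \<le> 0 then s (nat (- n)) x else 0)"
proof -
  have "series_apply (- 1) s (laurent_const x) n =
      (\<Sum>i\<in>{nat (- n)}. s i (laurent_const x (n - - 1 * int i)))"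
    unfolding series_apply_def
    by (rule Sum_any.expand_superset) (auto simp: laurent_const_def assms)
  then show ?thesis by (auto simp: laurent_const_def assms)
qed

lemma first_factor:
  assumes m: "m \<in> ext_power (Suc s)"
  shows "series_apply 1 sigma_bar_plus
      (sigma_bar_minus s \<circ> contract (Suc s) (bform 0) \<circ>
        series_apply (- 1) sigma_minus (laurent_const m)) n =
    (if n \<le> int s then contraction (bform (nat (int s - n))) m else 0)"
proof -
  define u where "u j = contraction (bform 0) (sigma_minus j m)" for j
  have u: "u j \<in> ext_power s" for j
    unfolding u_def by (intro eval.interior_ext_power schubert_ext_power m)
  \<comment> \<open>A second contraction with beta_0 gives zero, so the exchange rule for the
    downward series becomes available.\<close>
  then have "u j \<in> shifted_power s" for j
    by (rule kernel_shifted_power) (simp add: u_def)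
  note opposite = schubert_inv_opposite_down[OF this]
  have contract: "contract (Suc s) (bform 0) (sigma_minus j m) = u j" for j
    unfolding u_def by (rule contract_eq) (simp_all add: schubert_ext_power m)
  \<comment> \<open>Coefficients at positive powers of z are zero, and the definite description
    \<open>contract\<close> has to be evaluated there too.\<close>
  have contract_0: "contract (Suc s) (bform 0) 0 = 0"
    by (subst contract_eq) simp_all
  have "series_apply 1 sigma_bar_plus
      (sigma_bar_minus s \<circ> contract (Suc s) (bform 0) \<circ>
        series_apply (- 1) sigma_minus (laurent_const m)) n =
      Sum_any (\<lambda>i. if n \<le> int i \<and> i \<le> s then sigma_bar_minus (s - i) (u (nat (int i - n))) else 0)"
    unfolding series_apply_def[of 1]
    by (rule Sum_any.cong) (simp add: series_apply_const contract contract_0 opposite)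
  also have "\<dots> =
      (\<Sum>i\<le>s. if n \<le> int i \<and> i \<le> s then sigma_bar_minus (s - i) (u (nat (int i - n))) else 0)"
    by (rule Sum_any.expand_superset) (auto split: if_splits)
  \<comment> \<open>With l = s - i the sum becomes the action of the downward inverse series,
    multiplied by z^s.\<close>
  also have "\<dots> =
      (\<Sum>l\<le>s. if n \<le> int s - int l then sigma_bar_minus l (u (nat (int s - int l - n))) else 0)"
    by (rule sum.reindex_bij_witness[of _ "\<lambda>l. s - l" "\<lambda>i. s - i"]) (auto simp: of_nat_diff)
  also have "\<dots> = (if n \<le> int s then contraction (bform (nat (int s - n))) m else 0)"
  proof (cases "n \<le> int s")
    case False
    then show ?thesis by (auto intro!: sum.neutral)
  next
    case True
    define N where "N = nat (int s - n)"
    \<comment> \<open>The ranges up to \<open>s\<close> and up to \<open>N\<close> are compared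
      inside \<open>max s N\<close>: beyond \<open>s\<close> the operator vanishes on the s-th
      exterior power, beyond \<open>N\<close> the guard gives zero.\<close>
    have "(\<Sum>l\<le>s. if n \<le> int s - int l then sigma_bar_minus l (u (nat (int s - int l - n))) else 0) =
        (\<Sum>l\<le>max s N. if l \<le> N then sigma_bar_minus l (u (N - l)) else 0)"
      by (rule sum.mono_neutral_cong_left)
        (use True schubert_inv_vanish[OF u] in
          \<open>auto simp: N_def nat_diff_distrib' le_nat_iff intro!: arg_cong[of _ _ u] arg_cong2[of _ _ _ _ sigma_bar_minus]\<close>)
    also have "\<dots> = (\<Sum>l\<le>N. sigma_bar_minus l (u (N - l)))"
      by (rule sum.mono_neutral_cong_right) auto
    also have "\<dots> = (\<Sum>l\<le>N. sigma_bar_minus l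
        (\<Sum>j\<le>N - l. sigma_minus (N - l - j) (contraction (bform j) m)))"
      by (simp add: u_def contraction_schubert)
    also have "\<dots> = contraction (bform N) m"
      by (rule family_inverse_convolution) (simp_all add: schubert_inv.add schubert_inv_left)
    finally show ?thesis using True by (simp add: N_def)
  qed
  finally show ?thesis .
qed

lemma second_factor:
  assumes m: "m \<in> ext_power r"
  shows "series_apply 1 sigma_plus
      (series_apply (- 1) sigma_bar_minus
        (laurent_const (ext_gen (bvec 0) * sigma_bar_plus r m))) n =
    ext_gen (bvec (n + int r)) * m"
proof -
  let ?b = "ext_gen (frag_of 0) :: M0 ext"
  have bvec0: "bvec 0 = frag_of 0" using bvec_int[of 0] by simp
  have inner: "sigma_bar_minus k (?b * sigma_bar_plus r m) =
      (if k \<le> r then ?b * sigma_bar_plus (r - k) m else 0)" for k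
  proof -
    \<comment> \<open>The down-shift kills b_0, so the downward inverse series fixes b_0 and acts on
      the other factor alone.\<close>
    have "sigma_bar_minus k (?b * x) = ?b * sigma_bar_minus k x" for x
      by (cases k) (simp_all add: schubert_inv_gen_mult bvec_def)
    then show ?thesis by (simp add: schubert_inv_opposite_up[OF m])
  qed
  \<comment> \<open>The guard \<open>n \<le> int i\<close> coming from
    \<open>series_apply_const\<close> disappears: where it fails, the index exceeds \<open>r\<close>
    and the operator vanishes.\<close>
  have h: "series_apply (- 1) sigma_bar_minus (laurent_const (?b * sigma_bar_plus r m)) (n - int i) =
      (if int i \<le> n + int r then ?b * sigma_bar_plus (nat (n + int r - int i)) m else 0)" for i
  proof -
    have "nat (n + int r - int i) = r - nat (int i - n)" if "n \<le> int i" "int i \<le> n + int r"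
      using that by linarith
    moreover have "sigma_bar_plus (nat (n + int r - int i)) m = 0" if "\<not> n \<le> int i"
      by (rule schubert_inv_vanish[OF m]) (use that in linarith)
    ultimately show ?thesis
      by (auto simp: series_apply_const inner nat_le_iff)
  qed
  have "series_apply 1 sigma_plus
      (series_apply (- 1) sigma_bar_minus (laurent_const (?b * sigma_bar_plus r m))) n =
      Sum_any (\<lambda>i. sigma_plus i
        (if int i \<le> n + int r then ?b * sigma_bar_plus (nat (n + int r - int i)) m else 0))"
    unfolding series_apply_def[of 1] mult_1 h ..
  also have "\<dots> = ext_gen (bvec (n + int r)) * m"
  proof (cases "n + int r \<ge> 0")
    case False
    then have "\<not> int i \<le> n + int r" for i by linarith
    then show ?thesis using False by (simp add: bvec_def)
  next
    case True
    then obtain N where N: "n + int r = int N" by (metis nonneg_int_cases)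
    have "Sum_any (\<lambda>i. sigma_plus i (if int i \<le> int N then ?b * sigma_bar_plus (nat (int N - int i)) m else 0)) =
        (\<Sum>i\<le>N. sigma_plus i (if int i \<le> int N then ?b * sigma_bar_plus (nat (int N - int i)) m else 0))"
      by (rule Sum_any.expand_superset) (auto split: if_splits)
    also have "\<dots> = (\<Sum>i\<le>N. sigma_plus i (?b * sigma_bar_plus (N - i) m))"
      by (rule sum.cong) (auto simp: of_nat_diff[symmetric] simp del: of_nat_diff)
    \<comment> \<open>The upward series and its inverse cancel on \<open>m\<close>, leaving the
      upward series on b_0 only.\<close>
    also have "\<dots> = sigma_plus N ?b * m"
      by (rule family_inverse_mult) (simp_all add: multiplicative_family_schubert schubert_inv_right)
    finally show ?thesis unfolding N by simp
  qed
  finally show ?thesis by (simp add: bvec0)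
qed

section \<open>Tensor products\<close>

locale tensor_factors =
  fixes A B :: "'a::ring_1 set"
  assumes zero_A: "0 \<in> A" and diff_A: "x \<in> A \<Longrightarrow> y \<in> A \<Longrightarrow> x - y \<in> A"
    and zero_B: "0 \<in> B" and diff_B: "x \<in> B \<Longrightarrow> y \<in> B \<Longrightarrow> x - y \<in> B"
begin

lemma add_A: "x \<in> A \<Longrightarrow> y \<in> A \<Longrightarrow> x + y \<in> A"
  using diff_A[of x "0 - y"] diff_A[OF zero_A, of y] by simp

lemma add_B: "x \<in> B \<Longrightarrow> y \<in> B \<Longrightarrow> x + y \<in> B"
  using diff_B[of x "0 - y"] diff_B[OF zero_B, of y] by simp

lemma of_int_A: "x \<in> A \<Longrightarrow> of_int c * x \<in> A"
  by (induction c rule: int_induct[of _ 0])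
    (simp_all add: zero_A add_A diff_A distrib_right left_diff_distrib)

lemma of_int_B: "x \<in> B \<Longrightarrow> of_int c * x \<in> B"
  by (induction c rule: int_induct[of _ 0])
    (simp_all add: zero_B add_B diff_B distrib_right left_diff_distrib)

lemma sum_A: "(\<And>i. i \<in> I \<Longrightarrow> f i \<in> A) \<Longrightarrow> sum f I \<in> A"
  by (induction I rule: infinite_finite_induct) (simp_all add: zero_A add_A)

lemma sum_B: "(\<And>i. i \<in> I \<Longrightarrow> f i \<in> B) \<Longrightarrow> sum f I \<in> B"
  by (induction I rule: infinite_finite_induct) (simp_all add: zero_B add_B)

lemma tensor_relations_carrier: "tensor_relations A B \<subseteq> carrier (free_Abelian_group (A \<times> B))"
proof
  have frag: "Poly_Mapping.keys (frag_of (x, y)) \<subseteq> A \<times> B" if "x \<in> A" "y \<in> B" for x y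
    using that by simp
  have diff: "Poly_Mapping.keys (c - d) \<subseteq> A \<times> B"
    if "Poly_Mapping.keys c \<subseteq> A \<times> B" "Poly_Mapping.keys d \<subseteq> A \<times> B" for c d :: "'a \<times> 'a \<Rightarrow>\<^sub>0 int"
    using that keys_diff[of c d] by blast
  fix x assume "x \<in> tensor_relations A B"
  then show "x \<in> carrier (free_Abelian_group (A \<times> B))"
    unfolding tensor_relations_def carrier_free_Abelian_group_iff
    by (elim UnE CollectE exE conjE; simp only:; intro diff frag add_A add_B)
qed

lemma tensor_null_subgroup: "subgroup (tensor_null A B) (free_Abelian_group (A \<times> B))"
  unfolding tensor_null_def
  by (rule group.generate_is_subgroup[OF group_free_Abelian_group tensor_relations_carrier])

lemma tensor_null_keys: "x \<in> tensor_null A B \<Longrightarrow> Poly_Mapping.keys x \<subseteq> A \<times> B"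
  using subgroup.mem_carrier[OF tensor_null_subgroup] by simp

lemma tensor_null_zero: "0 \<in> tensor_null A B"
  using subgroup.one_closed[OF tensor_null_subgroup] by simp

lemma tensor_null_add: "x \<in> tensor_null A B \<Longrightarrow> y \<in> tensor_null A B \<Longrightarrow> x + y \<in> tensor_null A B"
  using subgroup.m_closed[OF tensor_null_subgroup] by fastforce

lemma tensor_null_uminus: "x \<in> tensor_null A B \<Longrightarrow> - x \<in> tensor_null A B"
  using subgroup.m_inv_closed[OF tensor_null_subgroup, of x] tensor_null_keys[of x] by simp

lemma tensor_null_diff: "x \<in> tensor_null A B \<Longrightarrow> y \<in> tensor_null A B \<Longrightarrow> x - y \<in> tensor_null A B"
  using tensor_null_add[OF _ tensor_null_uminus, of x y] by simp

lemma tensor_null_add_left: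
  "a \<in> A \<Longrightarrow> a' \<in> A \<Longrightarrow> b \<in> B \<Longrightarrow> frag_of (a + a', b) - frag_of (a, b) - frag_of (a', b) \<in> tensor_null A B"
  unfolding tensor_null_def by (rule generate.incl) (auto simp: tensor_relations_def)

lemma tensor_null_add_right:
  "a \<in> A \<Longrightarrow> b \<in> B \<Longrightarrow> b' \<in> B \<Longrightarrow> frag_of (a, b + b') - frag_of (a, b) - frag_of (a, b') \<in> tensor_null A B"
  unfolding tensor_null_def by (rule generate.incl) (auto simp: tensor_relations_def)

text \<open>Calculations are chained as congruences in the free abelian group and passed to cosets
  only at the end.\<close>

definition tensor_eq :: "('a \<times> 'a \<Rightarrow>\<^sub>0 int) \<Rightarrow> ('a \<times> 'a \<Rightarrow>\<^sub>0 int) \<Rightarrow> bool" where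
  "tensor_eq x y \<longleftrightarrow> x - y \<in> tensor_null A B"

lemma tensor_eq_refl: "tensor_eq x x"
  by (simp add: tensor_eq_def tensor_null_zero)

lemma tensor_eq_sym: "tensor_eq x y \<Longrightarrow> tensor_eq y x"
  using tensor_null_uminus[of "x - y"] by (simp add: tensor_eq_def)

lemma tensor_eq_trans [trans]: "tensor_eq x y \<Longrightarrow> tensor_eq y z \<Longrightarrow> tensor_eq x z"
  using tensor_null_add[of "x - y" "y - z"] by (simp add: tensor_eq_def)

lemma tensor_eq_add: "tensor_eq x y \<Longrightarrow> tensor_eq x' y' \<Longrightarrow> tensor_eq (x + x') (y + y')"
  using tensor_null_add[of "x - y" "x' - y'"] by (simp add: tensor_eq_def algebra_simps)

lemma tensor_eq_diff: "tensor_eq x y \<Longrightarrow> tensor_eq x' y' \<Longrightarrow> tensor_eq (x - x') (y - y')"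
  using tensor_null_diff[of "x - y" "x' - y'"] by (simp add: tensor_eq_def algebra_simps)

lemma tensor_eq_sum: "(\<And>i. i \<in> I \<Longrightarrow> tensor_eq (f i) (g i)) \<Longrightarrow> tensor_eq (sum f I) (sum g I)"
  by (induction I rule: infinite_finite_induct) (simp_all add: tensor_eq_refl tensor_eq_add)

lemma tensor_eq_left_add:
  "a \<in> A \<Longrightarrow> a' \<in> A \<Longrightarrow> b \<in> B \<Longrightarrow> tensor_eq (frag_of (a + a', b)) (frag_of (a, b) + frag_of (a', b))"
  using tensor_null_add_left[of a a' b] by (simp add: tensor_eq_def algebra_simps)

lemma tensor_eq_right_add:
  "a \<in> A \<Longrightarrow> b \<in> B \<Longrightarrow> b' \<in> B \<Longrightarrow> tensor_eq (frag_of (a, b + b')) (frag_of (a, b) + frag_of (a, b'))"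
  using tensor_null_add_right[of a b b'] by (simp add: tensor_eq_def algebra_simps)

lemma tensor_eq_left_zero: "b \<in> B \<Longrightarrow> tensor_eq (frag_of (0, b)) 0"
  using tensor_null_uminus[OF tensor_null_add_left[OF zero_A zero_A, of b]]
  by (simp add: tensor_eq_def)

lemma tensor_eq_right_zero: "a \<in> A \<Longrightarrow> tensor_eq (frag_of (a, 0)) 0"
  using tensor_null_uminus[OF tensor_null_add_right[OF _ zero_B zero_B, of a]]
  by (simp add: tensor_eq_def)

lemma tensor_eq_left_sum:
  assumes "\<And>i. i \<in> I \<Longrightarrow> f i \<in> A" "b \<in> B"
  shows "tensor_eq (frag_of (sum f I, b)) (\<Sum>i\<in>I. frag_of (f i, b))"
  using assms(1)
proof (induction I rule: infinite_finite_induct)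
  case (insert i I)
  then have "tensor_eq (frag_of (f i + sum f I, b)) (frag_of (f i, b) + frag_of (sum f I, b))"
    by (intro tensor_eq_left_add sum_A assms(2)) auto
  also have "tensor_eq \<dots> (frag_of (f i, b) + (\<Sum>i\<in>I. frag_of (f i, b)))"
    by (intro tensor_eq_add tensor_eq_refl insert.IH insert.prems) simp
  finally show ?case using insert.hyps by simp
qed (simp_all add: tensor_eq_left_zero assms(2))

lemma tensor_eq_right_sum:
  assumes "a \<in> A" "\<And>i. i \<in> I \<Longrightarrow> f i \<in> B"
  shows "tensor_eq (frag_of (a, sum f I)) (\<Sum>i\<in>I. frag_of (a, f i))"
  using assms(2)
proof (induction I rule: infinite_finite_induct)
  case (insert i I)
  then have "tensor_eq (frag_of (a, f i + sum f I)) (frag_of (a, f i) + frag_of (a, sum f I))"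
    by (intro tensor_eq_right_add sum_B assms(1)) auto
  also have "tensor_eq \<dots> (frag_of (a, f i) + (\<Sum>i\<in>I. frag_of (a, f i)))"
    by (intro tensor_eq_add tensor_eq_refl insert.IH insert.prems) simp
  finally show ?case using insert.hyps by simp
qed (simp_all add: tensor_eq_right_zero assms(1))

lemma tensor_eq_of_int:
  assumes "a \<in> A" "b \<in> B"
  shows "tensor_eq (frag_of (of_int c * a, b)) (frag_of (a, of_int c * b))"
proof (induction c rule: int_induct[of _ 0])
  case base
  show ?case
    using tensor_eq_trans[OF tensor_eq_left_zero[OF assms(2)] tensor_eq_sym[OF tensor_eq_right_zero[OF assms(1)]]]
    by simp
next
  case (step1 i)
  have "tensor_eq (frag_of (of_int i * a + a, b)) (frag_of (of_int i * a, b) + frag_of (a, b))"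
    by (intro tensor_eq_left_add of_int_A assms)
  also have "tensor_eq \<dots> (frag_of (a, of_int i * b) + frag_of (a, b))"
    by (intro tensor_eq_add step1 tensor_eq_refl)
  also have "tensor_eq \<dots> (frag_of (a, of_int i * b + b))"
    by (intro tensor_eq_sym[OF tensor_eq_right_add] of_int_B assms)
  finally show ?case by (simp add: distrib_right)
next
  case (step2 i)
  \<comment> \<open>Downward step: the tensor for \<open>i\<close> is the wanted one plus one more
    copy, which is then subtracted.\<close>
  have "tensor_eq (frag_of (of_int (i - 1) * a + a, b)) (frag_of (of_int (i - 1) * a, b) + frag_of (a, b))"
    by (intro tensor_eq_left_add of_int_A assms)
  from tensor_eq_sym[OF tensor_eq_diff[OF this tensor_eq_refl[of "frag_of (a, b)"]]]
  have "tensor_eq (frag_of (of_int (i - 1) * a, b)) (frag_of (of_int i * a, b) - frag_of (a, b))"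
    by (simp add: left_diff_distrib)
  also have "tensor_eq \<dots> (frag_of (a, of_int i * b) - frag_of (a, b))"
    by (intro tensor_eq_diff step2 tensor_eq_refl)
  also have "tensor_eq \<dots> (frag_of (a, of_int (i - 1) * b))"
  proof -
    have "tensor_eq (frag_of (a, of_int (i - 1) * b + b)) (frag_of (a, of_int (i - 1) * b) + frag_of (a, b))"
      by (intro tensor_eq_right_add of_int_B assms)
    from tensor_eq_diff[OF this tensor_eq_refl[of "frag_of (a, b)"]]
    show ?thesis by (simp add: left_diff_distrib)
  qed
  finally show ?case .
qed

text \<open>Bridge from the multiplicatively written quotient to sums in the free group: multiplying
  cosets adds representatives.\<close>

lemma finprod_pure_tensor:
  assumes "finite I" "\<And>i. i \<in> I \<Longrightarrow> a i \<in> A" "\<And>i. i \<in> I \<Longrightarrow> b i \<in> B"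
  shows "finprod (tensor_product A B) (\<lambda>i. pure_tensor A B (a i) (b i)) I =
    tensor_null A B #>\<^bsub>free_Abelian_group (A \<times> B)\<^esub> (\<Sum>i\<in>I. frag_of (a i, b i))"
proof -
  let ?F = "free_Abelian_group (A \<times> B)" and ?N = "tensor_null A B"
  interpret F: comm_group ?F by (rule abelian_free_Abelian_group)
  interpret N: normal ?N ?F by (rule F.subgroup_imp_normal[OF tensor_null_subgroup])
  interpret T: comm_group "tensor_product A B"
    by (rule comm_group_tensor_product) (auto intro: add_A add_B)
  have pure: "pure_tensor A B x y \<in> carrier (tensor_product A B)" if "x \<in> A" "y \<in> B" for x y
    using that F.rcosetsI[OF N.subset, of "frag_of (x, y)"]
    by (simp add: pure_tensor_def tensor_product_def FactGroup_def)
  show ?thesis using assms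
  proof (induction I rule: finite_induct)
    case empty
    have "?N #>\<^bsub>?F\<^esub> 0 = ?N"
      by (rule F.coset_join2) (simp_all add: tensor_null_subgroup tensor_null_zero)
    then show ?case
      unfolding T.finprod_empty sum.empty by (simp add: tensor_product_def FactGroup_def)
  next
    case (insert i I)
    have sum: "(\<Sum>i\<in>I. frag_of (a i, b i)) \<in> carrier ?F"
      by (rule sum_closed_free_Abelian_group) (use insert.prems in auto)
    have "finprod (tensor_product A B) (\<lambda>i. pure_tensor A B (a i) (b i)) (insert i I) =
        pure_tensor A B (a i) (b i) \<otimes>\<^bsub>tensor_product A B\<^esub>
          (?N #>\<^bsub>?F\<^esub> (\<Sum>i\<in>I. frag_of (a i, b i)))"
      using insert by (subst T.finprod_insert) (auto intro: pure)
    also have "\<dots> = ?N #>\<^bsub>?F\<^esub> (frag_of (a i, b i) + (\<Sum>i\<in>I. frag_of (a i, b i)))"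
      using N.rcos_sum[OF _ sum, of "frag_of (a i, b i)"] insert.prems
      by (simp add: tensor_product_def FactGroup_def pure_tensor_def)
    finally show ?case using insert.hyps by simp
  qed
qed

lemma finprod_pure_tensor_eq_one_iff:
  assumes "finite I" "\<And>i. i \<in> I \<Longrightarrow> a i \<in> A" "\<And>i. i \<in> I \<Longrightarrow> b i \<in> B"
  shows "finprod (tensor_product A B) (\<lambda>i. pure_tensor A B (a i) (b i)) I = \<one>\<^bsub>tensor_product A B\<^esub>
    \<longleftrightarrow> tensor_eq (\<Sum>i\<in>I. frag_of (a i, b i)) 0"
proof -
  have carrier: "(\<Sum>i\<in>I. frag_of (a i, b i)) \<in> carrier (free_Abelian_group (A \<times> B))"
    by (rule sum_closed_free_Abelian_group) (use assms in auto)
  let ?C = "tensor_null A B #>\<^bsub>free_Abelian_group (A \<times> B)\<^esub> (\<Sum>i\<in>I. frag_of (a i, b i))"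
  have prod: "finprod (tensor_product A B) (\<lambda>i. pure_tensor A B (a i) (b i)) I = ?C"
    by (rule finprod_pure_tensor) (fact assms)+
  have one: "\<one>\<^bsub>tensor_product A B\<^esub> = tensor_null A B"
    by (simp add: tensor_product_def FactGroup_def)
  have "?C = tensor_null A B \<longleftrightarrow> (\<Sum>i\<in>I. frag_of (a i, b i)) \<in> tensor_null A B"
    by (rule iffI)
      (erule group.coset_join1[OF group_free_Abelian_group _ carrier tensor_null_subgroup],
        rule group.coset_join2[OF group_free_Abelian_group carrier tensor_null_subgroup])
  then show ?thesis
    unfolding tensor_eq_def diff_zero by (subst prod, subst one)
qed

text \<open>Biadditive maps factor through the tensor product, so they detect nonzero tensors
  without a basis of the factors.\<close>

lemma tensor_eq_zero_biadditive:
  fixes h :: "'a \<times> 'a \<Rightarrow> 'c::ring_1"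
  assumes "tensor_eq x 0"
    and left: "\<And>a a' b. h (a + a', b) = h (a, b) + h (a', b)"
    and right: "\<And>a b b'. h (a, b + b') = h (a, b) + h (a, b')"
  shows "free_extend h x = 0"
proof -
  have rel: "free_extend h y = 0" if "y \<in> tensor_relations A B" for y
    using that unfolding tensor_relations_def
    by (auto simp: free_extend_diff left right)
  have "x \<in> tensor_null A B" using assms(1) by (simp add: tensor_eq_def)
  then show ?thesis
    unfolding tensor_null_def
  proof (induction rule: generate.induct)
    case (inv y)
    then have "Poly_Mapping.keys y \<subseteq> A \<times> B"
      using subsetD[OF tensor_relations_carrier, of y] by (simp only: carrier_free_Abelian_group_iff)
    then show ?case using rel[OF inv] free_extend_diff[of h 0 y] by (simp add: free_extend_zero)
  qed (simp_all add: rel free_extend_zero free_extend_add)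
qed

end

interpretation ext_factors: tensor_factors "ext_power p" "ext_power q" for p q
  by unfold_locales (auto intro: ext_power.diff)

section \<open>Pluecker relations\<close>

lemma ext_gen_expansion:
  assumes "finite K" "Poly_Mapping.keys v \<subseteq> K"
  shows "ext_gen v = (\<Sum>i\<in>K. of_int (Poly_Mapping.lookup v i) * ext_gen (frag_of i))"
proof -
  have "ext_gen v = (\<Sum>i\<in>Poly_Mapping.keys v. of_int (Poly_Mapping.lookup v i) * ext_gen (frag_of i))"
    by (subst frag_expansion[of v]) (simp add: frag_extend_def ext_gen_sum ext_gen_cmul)
  also have "\<dots> = (\<Sum>i\<in>K. of_int (Poly_Mapping.lookup v i) * ext_gen (frag_of i))"
    by (rule sum.mono_neutral_left) (use assms in \<open>auto simp: in_keys_iff\<close>)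
  finally show ?thesis .
qed

lemma gen_mult_wedge_member: "v \<in> set ms \<Longrightarrow> ext_gen v * wedge ms = 0"
proof (induction ms)
  case (Cons w ms)
  then show ?case by (auto simp: ext_gen_anticommute_left[of v w])
qed simp

text \<open>The contraction is a signed sum of products omitting one vector v_j, weighted by the
  i-th coordinate of v_j. Moving the weights across the tensor sign and summing over i rebuilds v_j
  in the second factor, where v_j * m = 0.\<close>

lemma plucker_of_wedge:
  assumes len: "length ms = Suc s" and K: "finite K" "\<And>v. v \<in> set ms \<Longrightarrow> Poly_Mapping.keys v \<subseteq> K"
  shows "ext_factors.tensor_eq s (Suc (Suc s))
    (\<Sum>i\<in>K. frag_of (contraction (bform i) (wedge ms), ext_gen (frag_of i) * wedge ms)) 0"
proof -
  let ?eq = "ext_factors.tensor_eq s (Suc (Suc s))"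
  let ?y = "\<lambda>i. ext_gen (frag_of i) * wedge ms"
  let ?x = "\<lambda>j. of_int ((- 1) ^ j) * wedge (take j ms @ drop (Suc j) ms)"
  let ?c = "\<lambda>i j. Poly_Mapping.lookup (ms ! j) i"
  have y: "?y i \<in> ext_power (Suc (Suc s))" for i
    by (rule ext_power_Suc, rule ext_power.wedge) (rule len)
  have x: "?x j \<in> ext_power s" if "j < Suc s" for j
    by (rule ext_factors.of_int_A, rule ext_power.wedge) (use that len in simp)
  have contr: "contraction (bform i) (wedge ms) = (\<Sum>j<Suc s. of_int (?c i j) * ?x j)" for i
    unfolding eval.interior_wedge_expansion len
    by (rule sum.cong)
      (simp_all only: eval_form_bform mult.assoc[symmetric] of_int_mult[symmetric] mult.commute)
  have "?eq (\<Sum>i\<in>K. frag_of (contraction (bform i) (wedge ms), ?y i))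
      (\<Sum>i\<in>K. \<Sum>j<Suc s. frag_of (of_int (?c i j) * ?x j, ?y i))"
    unfolding contr
    by (intro ext_factors.tensor_eq_sum ext_factors.tensor_eq_left_sum ext_factors.of_int_A x y) simp
  also have "?eq \<dots> (\<Sum>i\<in>K. \<Sum>j<Suc s. frag_of (?x j, of_int (?c i j) * ?y i))"
    by (intro ext_factors.tensor_eq_sum ext_factors.tensor_eq_of_int x y) simp
  also have "(\<Sum>i\<in>K. \<Sum>j<Suc s. frag_of (?x j, of_int (?c i j) * ?y i)) =
      (\<Sum>j<Suc s. \<Sum>i\<in>K. frag_of (?x j, of_int (?c i j) * ?y i))"
    by (rule sum.swap)
  also have "?eq \<dots> (\<Sum>j<Suc s. frag_of (?x j, \<Sum>i\<in>K. of_int (?c i j) * ?y i))"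
    by (intro ext_factors.tensor_eq_sum ext_factors.tensor_eq_sym[OF ext_factors.tensor_eq_right_sum]
        ext_factors.of_int_B x y) simp
  also have "(\<Sum>j<Suc s. frag_of (?x j, \<Sum>i\<in>K. of_int (?c i j) * ?y i)) = (\<Sum>j<Suc s. frag_of (?x j, 0))"
  proof (rule sum.cong)
    fix j assume "j \<in> {..<Suc s}"
    then have mem: "ms ! j \<in> set ms" using len by simp
    have "(\<Sum>i\<in>K. of_int (?c i j) * ?y i) = ext_gen (ms ! j) * wedge ms"
      by (simp add: ext_gen_expansion[OF K(1) K(2)[OF mem]] sum_distrib_right mult.assoc)
    then show "frag_of (?x j, \<Sum>i\<in>K. of_int (?c i j) * ?y i) = frag_of (?x j, 0)"
      by (simp add: gen_mult_wedge_member[OF mem])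
  qed simp
  also have "?eq \<dots> (\<Sum>j<Suc s. 0)"
    by (intro ext_factors.tensor_eq_sum ext_factors.tensor_eq_right_zero x) simp
  finally show ?thesis by simp
qed

section \<open>Primitive vectors and the converse\<close>

lemma eval_form_cmul_right: "eval_form \<mu> (frag_cmul c v) = c * eval_form \<mu> v"
  by (simp add: eval_form_def sum_distrib_left mult.left_commute)

lemma eval_form_cmul_left: "eval_form (frag_cmul c \<mu>) v = c * eval_form \<mu> v"
  by (subst eval_form_superset[of "Poly_Mapping.keys \<mu>"])
    (auto simp: eval_form_def sum_distrib_left mult.assoc)

lemmas eval_form_diff_left = additive_diff[of "\<lambda>\<mu>. eval_form \<mu> v" for v, OF eval_form_add_left]
lemmas eval_form_zero_left = additive_zero[of "\<lambda>\<mu>. eval_form \<mu> v" for v, OF eval_form_add_left]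

text \<open>\<open>d\<close> is the least positive value taken on \<open>v\<close> by integral
  forms. A coordinate not divisible by \<open>d\<close> would leave its remainder as a smaller
  positive value. The form attaining \<open>d\<close> takes the value 1 on v / d.\<close>

lemma primitive_part:
  assumes "v \<noteq> 0"
  obtains d w \<mu> where "d \<noteq> 0" "v = frag_cmul d w" "eval_form \<mu> w = 1"
proof -
  define V where "V = {n. n > 0 \<and> (\<exists>\<mu>. eval_form \<mu> v = int n)}"
  obtain j where j: "Poly_Mapping.lookup v j \<noteq> 0"
    using assms by (metis poly_mapping_eqI lookup_zero)
  have "nat \<bar>Poly_Mapping.lookup v j\<bar> \<in> V"
  proof -
    have "eval_form (frag_cmul (sgn (Poly_Mapping.lookup v j)) (bform j)) v = \<bar>Poly_Mapping.lookup v j\<bar>"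
      by (simp add: eval_form_cmul_left eval_form_bform abs_sgn mult.commute)
    then show ?thesis using j unfolding V_def by auto
  qed
  define d where "d = (LEAST n. n \<in> V)"
  have "d \<in> V" unfolding d_def by (rule LeastI) fact
  then obtain \<mu> where d: "d > 0" and \<mu>: "eval_form \<mu> v = int d" unfolding V_def by blast
  have dvd: "int d dvd Poly_Mapping.lookup v i" for i
  proof -
    let ?x = "Poly_Mapping.lookup v i"
    have "eval_form (bform i - frag_cmul (?x div int d) \<mu>) v = ?x mod int d"
      by (simp add: eval_form_diff_left eval_form_cmul_left eval_form_bform \<mu> minus_div_mult_eq_mod)
    moreover have "nat (?x mod int d) \<notin> V"
      using not_less_Least[of "nat (?x mod int d)" "\<lambda>n. n \<in> V"] d pos_mod_bound[of "int d" ?x]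
      unfolding d_def by linarith
    ultimately have "\<not> nat (?x mod int d) > 0" unfolding V_def by auto
    then have "?x mod int d = 0" using d pos_mod_sign[of "int d" ?x] by linarith
    then show ?thesis by (simp add: dvd_eq_mod_eq_0)
  qed
  define w where "w = Poly_Mapping.map (\<lambda>x. x div int d) v"
  have "v = frag_cmul (int d) w"
    using dvd by (intro poly_mapping_eqI) (simp add: w_def map.rep_eq when_def)
  moreover from this have "eval_form \<mu> w = 1"
    using \<mu> d by (simp add: eval_form_cmul_right)
  ultimately show thesis using that[of "int d" w \<mu>] d by simp
qed

text \<open>Contracting the Pluecker tensor of \<open>m\<close> with \<open>\<gamma>\<close> in its first factor shows that the vector
  \<open>v\<close> with coordinates \<open>\<gamma>(\<beta>\<^sub>i \<lrcorner> m)\<close> satisfies \<open>v \<and> m = 0\<close>. If \<open>\<mu>(w) = 1\<close> for the primitive part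
  \<open>w\<close> of such a \<open>v\<close>, then \<open>m = w \<and> (\<mu> \<lrcorner> m)\<close>, and \<open>\<mu> \<lrcorner> m\<close> inherits the hypothesis.\<close>

lemma plucker_imp_wedge:
  assumes "r \<ge> 1" "m \<in> ext_power r"
    and "\<And>\<gamma> v. (\<And>i. Poly_Mapping.lookup v i = ext_pair \<gamma> (contraction (bform i) m)) \<Longrightarrow>
      ext_gen v * m = 0"
  shows "m \<in> grassmann_cone r"
  using assms
proof (induction r arbitrary: m rule: dec_induct)
  case base
  obtain v where "m = ext_gen v" using base.prems(1) unfolding One_nat_def by (rule ext_power_1)
  then show ?case unfolding grassmann_cone_def by (auto intro!: exI[of _ "[v]"])
next
  case (step r)
  \<comment> \<open>Passes from basis forms to arbitrary ones by additivity, since the form dual to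
    a primitive vector need not be a basis form.\<close>
  have coord: "eval_form \<mu> v = ext_pair \<gamma> (contraction \<mu> x)"
    if "\<And>i. Poly_Mapping.lookup v i = ext_pair \<gamma> (contraction (bform i) x)" for \<mu> v \<gamma> x
  proof (induction \<mu> rule: frag_induct)
    case zero
    have "contraction 0 x = 0"
      using contraction_form_diff[of 0 0 x] by (simp only: diff_self)
    then show ?case using eval_form_zero_left[of v] by simp
  next
    case (one i)
    show ?case using that[of i] eval_form_bform[of i v] by (simp add: bform_def)
  next
    case (diff \<mu> \<mu>')
    then show ?case
      using eval_form_diff_left[of \<mu> \<mu>' v] by (simp add: contraction_form_diff ext_pair_diff_right)
  qed
  show ?case
  proof (cases "m = 0")
    case True
    have "m = wedge (replicate (Suc r) 0)" by (simp add: True)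
    then show ?thesis unfolding grassmann_cone_def by (metis (mono_tags, lifting) CollectI length_replicate)
  next
    case False
    have "\<exists>i. contraction (bform i) m \<noteq> 0"
      using contraction_zero_imp_const[of m] augmentation_ext_power[OF step.prems(1)] False by auto
    then obtain i \<gamma> where i: "ext_pair \<gamma> (contraction (bform i) m) \<noteq> 0"
      using ext_pair_nondegenerate[OF eval.interior_ext_power[OF step.prems(1)]] by metis
    define v where "v = Abs_poly_mapping (\<lambda>i. ext_pair \<gamma> (contraction (bform i) m))"
    \<comment> \<open>Only finitely many basis forms contract \<open>m\<close> to something nonzero,
      so the coordinates do define a vector of \<open>M0\<close>.\<close>
    have "finite {i. ext_pair \<gamma> (contraction (bform i) m) \<noteq> 0}"
      by (rule finite_subset[OF _ finite_contraction[of m]]) auto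
    then have v: "Poly_Mapping.lookup v i = ext_pair \<gamma> (contraction (bform i) m)" for i
      unfolding v_def by simp
    have "v \<noteq> 0" using v[of i] i by auto
    then obtain d w \<mu> where d: "d \<noteq> 0" and w: "v = frag_cmul d w" and \<mu>: "eval_form \<mu> w = 1"
      by (rule primitive_part)
    have "of_int d * (ext_gen w * m) = 0"
      using step.prems(2)[OF v] by (simp add: w ext_gen_cmul mult.assoc)
    then have "ext_gen w * m = 0" using d by (rule ext_torsion_free)
    then have m: "m = ext_gen w * contraction \<mu> m"
      using eval.interior_gen_mult[of \<mu> w m] \<mu> by simp
    have "contraction \<mu> m \<in> grassmann_cone r"
    proof (rule step.IH)
      show "contraction \<mu> m \<in> ext_power r" by (rule eval.interior_ext_power[OF step.prems(1)])
    next
      fix \<gamma>' v'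
      assume v': "\<And>i. Poly_Mapping.lookup v' i = ext_pair \<gamma>' (contraction (bform i) (contraction \<mu> m))"
      \<comment> \<open>Up to sign, \<open>v'\<close> is the vector attached to \<open>m\<close> and
        \<open>ext_gen \<mu> * \<gamma>'\<close>; the sign comes from swapping two
        contractions.\<close>
      have "Poly_Mapping.lookup (- v') i = ext_pair (ext_gen \<mu> * \<gamma>') (contraction (bform i) m)" for i
        unfolding ext_pair_gen_mult
          interior_anticommute[OF eval.linear_form_axioms eval.linear_form_axioms, of \<mu> "bform i"]
        by (simp add: v' ext_pair_uminus_right)
      then have "ext_gen (- v') * m = 0" by (rule step.prems(2))
      then have "ext_gen v' * m = 0" by (simp add: ext_gen_uminus)
      \<comment> \<open>This value pairs with a double contraction by \<open>\<mu>\<close>, hence is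
        zero; contracting \<open>ext_gen v' * m = 0\<close> with \<open>\<mu>\<close> then leaves
        the claim.\<close>
      moreover have "eval_form \<mu> v' = 0" using coord[OF v', of \<mu>] by simp
      ultimately show "ext_gen v' * contraction \<mu> m = 0"
        using eval.interior_gen_mult[of \<mu> v' m] by simp
    qed
    then obtain ms where "contraction \<mu> m = wedge ms" "length ms = r"
      unfolding grassmann_cone_def by blast
    then have "m = wedge (w # ms)" "length (w # ms) = Suc r" using m by simp_all
    then show ?thesis unfolding grassmann_cone_def by blast
  qed
qed

text \<open>The freedom in \<open>J\<close> reconciles index sets: the residue runs over the exact
  support, while expanding vectors in coordinates needs a larger set, and the added terms have a
  zero factor.\<close>

lemma grassmann_cone_iff_plucker:
  assumes m: "m \<in> ext_power (Suc s)" and J: "finite J" 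
      "\<And>j. j \<notin> J \<Longrightarrow> contraction (bform j) m = 0 \<or> ext_gen (frag_of j) * m = 0"
  shows "m \<in> grassmann_cone (Suc s) \<longleftrightarrow> ext_factors.tensor_eq s (Suc (Suc s))
    (\<Sum>j\<in>J. frag_of (contraction (bform j) m, ext_gen (frag_of j) * m)) 0"
proof
  let ?eq = "ext_factors.tensor_eq s (Suc (Suc s))"
  let ?T = "\<lambda>j. frag_of (contraction (bform j) m, ext_gen (frag_of j) * m)"
  assume "m \<in> grassmann_cone (Suc s)"
  then obtain ms where ms: "m = wedge ms" "length ms = Suc s" unfolding grassmann_cone_def by blast
  let ?K = "J \<union> (\<Union>v\<in>set ms. Poly_Mapping.keys v)"
  have "?eq (\<Sum>j\<in>?K - J. ?T j) (\<Sum>j\<in>?K - J. 0)"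
  proof (rule ext_factors.tensor_eq_sum)
    fix j assume "j \<in> ?K - J"
    then consider "contraction (bform j) m = 0" | "ext_gen (frag_of j) * m = 0" using J(2) by blast
    then show "?eq (?T j) 0"
      using ext_factors.tensor_eq_left_zero[OF ext_power_Suc[OF m]]
        ext_factors.tensor_eq_right_zero[OF eval.interior_ext_power[OF m]] by cases simp_all
  qed
  then have "?eq (\<Sum>j\<in>?K - J. ?T j) 0" by simp
  moreover have "?eq (\<Sum>j\<in>?K. ?T j) 0"
    unfolding ms(1) by (rule plucker_of_wedge[OF ms(2)]) (use J(1) in auto)
  ultimately have "?eq ((\<Sum>j\<in>?K. ?T j) - (\<Sum>j\<in>?K - J. ?T j)) (0 - 0)"
    by (intro ext_factors.tensor_eq_diff)
  moreover have "(\<Sum>j\<in>?K. ?T j) = (\<Sum>j\<in>?K - J. ?T j) + (\<Sum>j\<in>J. ?T j)"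
    by (rule sum.subset_diff) (use J(1) in auto)
  ultimately show "?eq (\<Sum>j\<in>J. ?T j) 0" by simp
next
  let ?eq = "ext_factors.tensor_eq s (Suc (Suc s))"
  let ?T = "\<lambda>j. frag_of (contraction (bform j) m, ext_gen (frag_of j) * m)"
  assume eq: "?eq (\<Sum>j\<in>J. ?T j) 0"
  show "m \<in> grassmann_cone (Suc s)"
  proof (rule plucker_imp_wedge)
    fix \<gamma> v
    assume v: "\<And>i. Poly_Mapping.lookup v i = ext_pair \<gamma> (contraction (bform i) m)"
    \<comment> \<open>Pairing the first tensor factor with \<open>\<gamma>\<close> turns the
      Pluecker tensor into \<open>ext_gen v * m\<close>.\<close>
    let ?h = "\<lambda>(a, b). of_int (ext_pair \<gamma> a) * b :: M0 ext"
    have "free_extend ?h (\<Sum>j\<in>J. ?T j) = 0"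
      by (rule ext_factors.tensor_eq_zero_biadditive[OF eq])
        (simp_all add: ext_pair_add_right distrib_left distrib_right)
    then have "(\<Sum>j\<in>J. of_int (Poly_Mapping.lookup v j) * (ext_gen (frag_of j) * m)) = 0"
      by (simp add: additive_sum[of "free_extend ?h", OF free_extend_add] v)
    also have "(\<Sum>j\<in>J. of_int (Poly_Mapping.lookup v j) * (ext_gen (frag_of j) * m)) =
        (\<Sum>j\<in>J \<union> Poly_Mapping.keys v. of_int (Poly_Mapping.lookup v j) * (ext_gen (frag_of j) * m))"
    proof (rule sum.mono_neutral_left)
      show "\<forall>j\<in>(J \<union> Poly_Mapping.keys v) - J.
          of_int (Poly_Mapping.lookup v j) * (ext_gen (frag_of j) * m) = 0"
      proof
        fix j assume "j \<in> (J \<union> Poly_Mapping.keys v) - J"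
        then consider "contraction (bform j) m = 0" | "ext_gen (frag_of j) * m = 0" using J(2) by blast
        then show "of_int (Poly_Mapping.lookup v j) * (ext_gen (frag_of j) * m) = 0"
          by cases (simp_all add: v)
      qed
    qed (simp_all add: J(1))
    also have "\<dots> = ext_gen v * m"
      by (simp add: ext_gen_expansion[of "J \<union> Poly_Mapping.keys v" v] J(1) sum_distrib_right mult.assoc)
    finally show "ext_gen v * m = 0" by simp
  qed (simp_all add: m)
qed

theorem theorem0p1:
  fixes r :: nat and m :: "M0 ext"
  assumes "r \<ge> 1" and "m \<in> ext_power r"
  shows "m \<in> grassmann_cone r \<longleftrightarrow>
    residue_tensor (ext_power (r - 1)) (ext_power (r + 1))
      (series_apply 1 sigma_bar_plus
        (sigma_bar_minus (r - 1) \<circ> contract r (bform 0) \<circ>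
          series_apply (-1) sigma_minus (laurent_const m)))
      (series_apply 1 sigma_plus
        (series_apply (-1) sigma_bar_minus
          (laurent_const (ext_gen (bvec 0) * sigma_bar_plus r m))))
    = \<one>\<^bsub>tensor_product (ext_power (r - 1)) (ext_power (r + 1))\<^esub>"
proof -
  obtain s where r: "r = Suc s" using assms(1) by (cases r) auto
  have m: "m \<in> ext_power (Suc s)" using assms(2) r by simp
  define f where "f n = (if n \<le> int s then contraction (bform (nat (int s - n))) m else 0)" for n
  define g where "g n = ext_gen (bvec (n + int (Suc s))) * m" for n
  \<comment> \<open>The factors carry z^s and z^(-s-1), so in the coefficient of z^(-1) the index i
    = s - j matches beta_j with b_j.\<close>
  have g_residue: "g (- 1 - i) = ext_gen (bvec (int s - i)) * m" for i
    by (simp add: g_def)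
  let ?I = "{i. f i \<noteq> 0 \<and> g (- 1 - i) \<noteq> 0}"
  let ?J = "{j. contraction (bform j) m \<noteq> 0 \<and> ext_gen (frag_of j) * m \<noteq> 0}"
  have J: "finite ?J" by (rule finite_subset[OF _ finite_contraction[of m]]) auto
  \<comment> \<open>For i > s the coefficient \<open>f i\<close> is zero, so truncation by
    \<open>nat\<close> loses nothing on the support.\<close>
  have bij: "bij_betw (\<lambda>j. int s - int j) ?J ?I"
    by (rule bij_betwI[of _ _ _ "\<lambda>i. nat (int s - i)"])
      (auto simp: f_def g_residue bvec_def split: if_splits)
  have I: "finite ?I" using bij_betw_finite[OF bij] J by blast
  have f_power: "f i \<in> ext_power s" for i
    by (simp add: f_def eval.interior_ext_power m)
  have g_power: "g i \<in> ext_power (Suc (Suc s))" for i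
    by (simp add: g_def ext_power_Suc m)
  have "m \<in> grassmann_cone r \<longleftrightarrow> ext_factors.tensor_eq s (Suc (Suc s))
      (\<Sum>j\<in>?J. frag_of (contraction (bform j) m, ext_gen (frag_of j) * m)) 0"
    unfolding r by (rule grassmann_cone_iff_plucker[OF m J]) blast
  also have "(\<Sum>j\<in>?J. frag_of (contraction (bform j) m, ext_gen (frag_of j) * m)) =
      (\<Sum>i\<in>?I. frag_of (f i, g (- 1 - i)))"
    by (subst sum.reindex_bij_betw[OF bij, symmetric]) (simp add: f_def g_residue)
  also have "ext_factors.tensor_eq s (Suc (Suc s)) \<dots> 0 \<longleftrightarrow>
      residue_tensor (ext_power s) (ext_power (Suc (Suc s))) f g =
      \<one>\<^bsub>tensor_product (ext_power s) (ext_power (Suc (Suc s)))\<^esub>"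
    unfolding residue_tensor_def
    by (rule ext_factors.finprod_pure_tensor_eq_one_iff[symmetric]) (simp_all only: I f_power g_power)
  also have "f = series_apply 1 sigma_bar_plus
        (sigma_bar_minus (r - 1) \<circ> contract r (bform 0) \<circ>
          series_apply (-1) sigma_minus (laurent_const m))"
    using first_factor[OF m] by (intro ext) (simp add: f_def r)
  also have "g = series_apply 1 sigma_plus
        (series_apply (-1) sigma_bar_minus
          (laurent_const (ext_gen (bvec 0) * sigma_bar_plus r m)))"
    using second_factor[OF m] by (intro ext) (simp add: g_def r)
  finally show ?thesis by (simp add: r comp_def)
qed

end
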